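(* Let $\mathcal G$ be the Renewal shift ultragraph, with vertices $\{v_i:i\in\mathbb N\}$ and edges $\{e\}\cup\{f_i:i\in\mathbb N\}$, where $s(e)=v_1$, $r(e)=\{v_i:i\in\mathbb N\}$, $s(f_i)=v_{i+1}$ and $r(f_i)=\{v_i\}$ for all $i\in\mathbb N$. Let $(X,\sigma)$ be the Deaconu-Renault system associated with $\mathcal G$. Then its topological entropy is $h(\sigma)=\log 2$.
   Context: $\mathbb N=\{1,2,\dots\}$. An ultragraph is $\mathcal G=(G^0,\mathcal G^1,r,s)$ with $G^0,\mathcal G^1$ countable sets, $s:\mathcal G^1\to G^0$, and $r:\mathcal G^1\to P(G^0)\setminus\{\emptyset\}$. $\mathcal G^0$ is the smallest subset of $P(G^0)$ containing all $\{v\}$ ($v\in G^0$) and all $r(e)$ ($e\in\mathcal G^1$) and closed under finite unions and nonempty finite intersections. A finite path of length $k\ge1$ is $\alpha=e_1\dots e_k$ with $s(e_{i+1})\in r(e_i)$; $s(\alpha)=s(e_1)$, $r(\alpha)=r(e_k)$. Infinite paths are defined similarly; their set is $\mathfrak p^\infty$. $\mathfrak p$ (ultrapaths) is the set of all pairs $(\alpha,A)$ with $\alpha$ a finite path of length $\ge1$, $A\in\mathcal G^0$, $A\subseteq r(\alpha)$, together with all $A\in\mathcal G^0$, identified with $(A,A)$ and of length $0$. For $A\subseteq G^0$ let $\varepsilon(A)=\{e\in\mathcal G^1:s(e)\in A\}$; $A\in\mathcal G^0$ is an infinite emitter if $\varepsilon(A)$ is infinite, and a minimal infinite emitter if moreover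 no proper subset of it in $\mathcal G^0$ is an infinite emitter. $M_\alpha$ is the set of minimal infinite emitters contained in $r(\alpha)$. The space is $X=\mathfrak p^\infty\cup X_{fin}$, with $X_{fin}=\{(\alpha,A)\in\mathfrak p:|\alpha|\ge1,A\in M_\alpha\}\cup\{(A,A):A\in\mathcal G^0\text{ a minimal infinite emitter}\}$. Its topology has as basis the sets $D_{(\beta,B)}=\{(\beta,A):A\subseteq B,A\in M_\beta\}\cup\{y\in X:y=\beta\gamma',\ |\gamma'|\ge1,\ s(\gamma')\in B\}$ for $(\beta,B)\in\mathfrak p$, $|\beta|\ge1$, and $D_{(\beta,B),F}=\{(\beta,B)\}\cup\{y\in X:y=\beta\gamma',\ \gamma'_1\in\varepsilon(B)\setminus F\}$ for $(\beta,B)\in X_{fin}$ and $F\subseteq\varepsilon(B)$ finite (if $(\beta,B)=(B,B)$ has length $0$, then $\beta\gamma'$ means $\gamma'$). (For the Renewal ultragraph the only minimal infinite emitter is $r(e)=G^0$, so $X_{fin}$ consists of $(r(e),r(e))$ and the pairs $(\alpha,r(e))$ with $\alpha$ a finite path with last edge $e$.) The shift $\sigma$ has $Dom(\sigma)$ equal to the set of elements of $X$ of length $\ge1$ (including infinite paths), and $\sigma(\gamma_1\gamma_2\dots)=\gamma_2\gamma_3\dots$, $\sigma(\gamma_1\dots\gamma_n,A)=(\gamma_2\dots\gamma_n,A)$ for $n\ge2$, $\sigma(\gamma_1,A)=(A,A)$. Put $Dom(\sigma^n)=\sigma^{-1}(Dom(\sigma^{n-1}))$. Topological entropy. For families $\alpha,\beta$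 of subsets of $X$ let $\alpha\vee\beta=\{A\cap B:A\in\alpha,B\in\beta\}$ and $\sigma^{-i}(\alpha)=\{\sigma^{-i}(A):A\in\alpha\}$, where $\sigma^{-i}(A)=\{x\in Dom(\sigma^i):\sigma^i(x)\in A\}$. For compact $K\subseteq X$, an open cover $\alpha$ of $K$ (open subsets of $X$ whose union contains $K$) and $n\in\mathbb N$, let $\alpha_n=\alpha\vee\sigma^{-1}(\alpha)\vee\dots\vee\sigma^{-n}(\alpha)$, a cover of $K_n=K\cap\sigma^{-1}(K)\cap\dots\cap\sigma^{-n}(K)$. $N(\alpha_n,K_n)$ is the smallest cardinality of a subfamily of $\alpha_n$ covering $K_n$ (with $N=1$ if $K_n=\emptyset$); $h(\alpha,\sigma,K)=\lim_{n\to\infty}\frac1n\log N(\alpha_n,K_n)$ (this limit exists); $h(\sigma,K)=\sup_\alpha h(\alpha,\sigma,K)$ over open covers $\alpha$ of $K$; $h(\sigma)=\sup_Kh(\sigma,K)$ over compact $K\subseteq X$. *)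

theory Defs
  imports "HOL-Analysis.Analysis" "HOL-Library.Omega_Words_Fun"
begin

section \<open>Ultragraphs\<close>

record ('v, 'e) ultragraph =
  verts :: "'v set"
  edges :: "'e set"
  src :: "'e \<Rightarrow> 'v"
  rng :: "'e \<Rightarrow> 'v set"

definition is_ultragraph :: "('v, 'e) ultragraph \<Rightarrow> bool" where
  "is_ultragraph G \<longleftrightarrow> countable (verts G) \<and> countable (edges G) \<and>
     (\<forall>e\<in>edges G. src G e \<in> verts G) \<and>
     (\<forall>e\<in>edges G. rng G e \<subseteq> verts G \<and> rng G e \<noteq> {})"

inductive_set gverts :: "('v, 'e) ultragraph \<Rightarrow> 'v set set" for G where
  vertex: "v \<in> verts G \<Longrightarrow> {v} \<in> gverts G"
| range: "e \<in> edges G \<Longrightarrow> rng G e \<in> gverts G"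
| union: "A \<in> gverts G \<Longrightarrow> B \<in> gverts G \<Longrightarrow> A \<union> B \<in> gverts G"
| inter: "A \<in> gverts G \<Longrightarrow> B \<in> gverts G \<Longrightarrow> A \<inter> B \<noteq> {} \<Longrightarrow> A \<inter> B \<in> gverts G"

definition emitted :: "('v, 'e) ultragraph \<Rightarrow> 'v set \<Rightarrow> 'e set" where
  "emitted G A = {e \<in> edges G. src G e \<in> A}"

definition infinite_emitter :: "('v, 'e) ultragraph \<Rightarrow> 'v set \<Rightarrow> bool" where
  "infinite_emitter G A \<longleftrightarrow> A \<in> gverts G \<and> infinite (emitted G A)"

definition min_infinite_emitter :: "('v, 'e) ultragraph \<Rightarrow> 'v set \<Rightarrow> bool" where
  "min_infinite_emitter G A \<longleftrightarrow>
     infinite_emitter G A \<and> (\<forall>B. B \<subset> A \<longrightarrow> \<not> infinite_emitter G B)"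

definition finite_path :: "('v, 'e) ultragraph \<Rightarrow> 'e list \<Rightarrow> bool" where
  "finite_path G \<alpha> \<longleftrightarrow> \<alpha> \<noteq> [] \<and> set \<alpha> \<subseteq> edges G \<and>
     (\<forall>i. Suc i < length \<alpha> \<longrightarrow> src G (\<alpha> ! Suc i) \<in> rng G (\<alpha> ! i))"

definition infinite_path :: "('v, 'e) ultragraph \<Rightarrow> (nat \<Rightarrow> 'e) \<Rightarrow> bool" where
  "infinite_path G x \<longleftrightarrow> (\<forall>i. x i \<in> edges G) \<and> (\<forall>i. src G (x (Suc i)) \<in> rng G (x i))"

definition path_rng :: "('v, 'e) ultragraph \<Rightarrow> 'e list \<Rightarrow> 'v set" where
  "path_rng G \<alpha> = rng G (last \<alpha>)"

definition min_emitters_in_range :: "('v, 'e) ultragraph \<Rightarrow> 'e list \<Rightarrow> 'v set set" where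
  "min_emitters_in_range G \<alpha> = {A. min_infinite_emitter G A \<and> A \<subseteq> path_rng G \<alpha>}"


section \<open>The ultragraph shift space\<close>

text \<open>\<open>FinP \<alpha> A\<close> is the pair \<open>(\<alpha>, A)\<close>; the length-zero path \<open>(A, A)\<close> is encoded as \<open>FinP [] A\<close>.
  Infinite paths are indexed from \<open>0\<close>.\<close>

datatype ('v, 'e) upath = FinP "'e list" "'v set" | InfP "nat \<Rightarrow> 'e"

fun ulength :: "('v, 'e) upath \<Rightarrow> enat" where
  "ulength (FinP \<alpha> A) = enat (length \<alpha>)"
| "ulength (InfP x) = \<infinity>"

text \<open>The first edge is meaningful only for paths of length at least one.\<close>

fun first_edge :: "('v, 'e) upath \<Rightarrow> 'e" where
  "first_edge (FinP \<alpha> A) = hd \<alpha>"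
| "first_edge (InfP x) = x 0"

fun uconc :: "'e list \<Rightarrow> ('v, 'e) upath \<Rightarrow> ('v, 'e) upath" where
  "uconc \<beta> (FinP \<alpha> A) = FinP (\<beta> @ \<alpha>) A"
| "uconc \<beta> (InfP x) = InfP (conc \<beta> x)"

definition ultrapaths :: "('v, 'e) ultragraph \<Rightarrow> ('v, 'e) upath set" where
  "ultrapaths G =
     {FinP \<alpha> A |\<alpha> A. finite_path G \<alpha> \<and> A \<in> gverts G \<and> A \<subseteq> path_rng G \<alpha>} \<union>
     {FinP [] A |A. A \<in> gverts G}"

definition X_fin :: "('v, 'e) ultragraph \<Rightarrow> ('v, 'e) upath set" where
  "X_fin G =
     {FinP \<alpha> A |\<alpha> A. finite_path G \<alpha> \<and> A \<in> min_emitters_in_range G \<alpha>} \<union>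
     {FinP [] A |A. min_infinite_emitter G A}"

definition shift_space :: "('v, 'e) ultragraph \<Rightarrow> ('v, 'e) upath set" where
  "shift_space G = {InfP x |x. infinite_path G x} \<union> X_fin G"

definition cyl :: "('v, 'e) ultragraph \<Rightarrow> 'e list \<Rightarrow> 'v set \<Rightarrow> ('v, 'e) upath set" where
  "cyl G \<beta> B =
     {FinP \<beta> A |A. A \<subseteq> B \<and> A \<in> min_emitters_in_range G \<beta>} \<union>
     {y \<in> shift_space G. \<exists>\<gamma>. y = uconc \<beta> \<gamma> \<and> 1 \<le> ulength \<gamma> \<and> src G (first_edge \<gamma>) \<in> B}"

definition cyl_minus ::
  "('v, 'e) ultragraph \<Rightarrow> 'e list \<Rightarrow> 'v set \<Rightarrow> 'e set \<Rightarrow> ('v, 'e) upath set" where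
  "cyl_minus G \<beta> B F =
     {FinP \<beta> B} \<union>
     {y \<in> shift_space G. \<exists>\<gamma>. y = uconc \<beta> \<gamma> \<and> 1 \<le> ulength \<gamma> \<and> first_edge \<gamma> \<in> emitted G B - F}"

definition shift_basis :: "('v, 'e) ultragraph \<Rightarrow> ('v, 'e) upath set set" where
  "shift_basis G =
     {cyl G \<beta> B |\<beta> B. FinP \<beta> B \<in> ultrapaths G \<and> \<beta> \<noteq> []} \<union>
     {cyl_minus G \<beta> B F |\<beta> B F. FinP \<beta> B \<in> X_fin G \<and> F \<subseteq> emitted G B \<and> finite F}"

definition shift_topology :: "('v, 'e) ultragraph \<Rightarrow> ('v, 'e) upath topology" where
  "shift_topology G = topology_generated_by (shift_basis G)"

text \<open>The shift map is undefined on paths of length zero; its value there is a dummy.\<close>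

fun shift :: "('v, 'e) upath \<Rightarrow> ('v, 'e) upath" where
  "shift (FinP \<alpha> A) = FinP (tl \<alpha>) A"
| "shift (InfP x) = InfP (\<lambda>i. x (Suc i))"

definition shift_domain :: "('v, 'e) ultragraph \<Rightarrow> ('v, 'e) upath set" where
  "shift_domain G = {x \<in> shift_space G. 1 \<le> ulength x}"

lemma uconc_append: "uconc (\<beta> @ \<delta>) \<gamma> = uconc \<beta> (uconc \<delta> \<gamma>)"
  by (cases \<gamma>) auto

lemma ulength_uconc: "ulength (uconc \<delta> \<gamma>) = enat (length \<delta>) + ulength \<gamma>"
  by (cases \<gamma>) auto

lemma first_edge_uconc: "\<delta> \<noteq> [] \<Longrightarrow> first_edge (uconc \<delta> \<gamma>) = hd \<delta>"
  by (cases \<gamma>) (auto simp: conc_def hd_conv_nth nth_append)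

lemma one_le_ulength_uconc: "\<delta> \<noteq> [] \<Longrightarrow> 1 \<le> ulength (uconc \<delta> \<gamma>)"
  by (cases \<gamma>) (auto simp: one_enat_def Suc_le_eq)

lemma cyl_subset_shift_space: "finite_path G \<beta> \<Longrightarrow> cyl G \<beta> B \<subseteq> shift_space G"
  by (auto simp: cyl_def shift_space_def X_fin_def)

lemma cyl_minus_subset_shift_space: "FinP \<beta> B \<in> X_fin G \<Longrightarrow> cyl_minus G \<beta> B F \<subseteq> shift_space G"
  by (auto simp: cyl_minus_def shift_space_def)

lemma finite_path_prefix: "infinite_path G x \<Longrightarrow> 0 < n \<Longrightarrow> finite_path G (map x [0..<n])"
  by (auto simp: finite_path_def infinite_path_def)

lemma shift_basis_subset_shift_space:
  assumes "D \<in> shift_basis G" shows "D \<subseteq> shift_space G"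
proof -
  from assms consider
    \<beta> B where "D = cyl G \<beta> B" "FinP \<beta> B \<in> ultrapaths G" "\<beta> \<noteq> []"
  | \<beta> B F where "D = cyl_minus G \<beta> B F" "FinP \<beta> B \<in> X_fin G"
    unfolding shift_basis_def by auto
  then show ?thesis
  proof cases
    case 1
    then have "finite_path G \<beta>" by (auto simp: ultrapaths_def)
    then show ?thesis using 1 cyl_subset_shift_space by metis
  next
    case 2
    then show ?thesis using cyl_minus_subset_shift_space by metis
  qed
qed

lemma cyl_prefix_in_basis:
  assumes "infinite_path G x" "0 < n"
  shows "cyl G (map x [0..<n]) (rng G (x (n - 1))) \<in> shift_basis G"
    and "InfP x \<in> cyl G (map x [0..<n]) (rng G (x (n - 1)))"
proof -
  have "path_rng G (map x [0..<n]) = rng G (x (n - 1))"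
    using assms(2) by (simp add: path_rng_def last_map)
  moreover have "rng G (x (n - 1)) \<in> gverts G"
    using assms(1) by (auto simp: infinite_path_def intro: gverts.range)
  ultimately have "FinP (map x [0..<n]) (rng G (x (n - 1))) \<in> ultrapaths G"
    using finite_path_prefix[OF assms] by (auto simp: ultrapaths_def)
  then show "cyl G (map x [0..<n]) (rng G (x (n - 1))) \<in> shift_basis G"
    using assms(2) unfolding shift_basis_def by fastforce
  have eq: "InfP x = uconc (map x [0..<n]) (InfP (\<lambda>i. x (n + i)))"
    by (auto simp: conc_def)
  have "src G (first_edge (InfP (\<lambda>i. x (n + i)) :: ('a, 'b) upath)) \<in> rng G (x (n - 1))"
    using assms unfolding infinite_path_def by (metis Suc_pred' add_0_right first_edge.simps(2))
  moreover have "InfP x \<in> shift_space G"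
    using assms(1) by (auto simp: shift_space_def)
  ultimately show "InfP x \<in> cyl G (map x [0..<n]) (rng G (x (n - 1)))"
    unfolding cyl_def using eq by (auto simp del: uconc.simps intro!: exI[of _ "InfP (\<lambda>i. x (n + i))"])
qed

lemma cyl_append_subset:
  assumes "finite_path G (\<beta> @ \<delta>)" "\<delta> \<noteq> []" "P (hd \<delta>)"
  shows "cyl G (\<beta> @ \<delta>) C \<subseteq>
    {y \<in> shift_space G. \<exists>\<gamma>. y = uconc \<beta> \<gamma> \<and> 1 \<le> ulength \<gamma> \<and> P (first_edge \<gamma>)}"
proof
  fix y assume y: "y \<in> cyl G (\<beta> @ \<delta>) C"
  then obtain \<gamma> where "y = uconc (\<beta> @ \<delta>) \<gamma>"
    unfolding cyl_def by (force intro: that[of "FinP [] _"])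
  then have "y = uconc \<beta> (uconc \<delta> \<gamma>)"
    by (simp add: uconc_append)
  moreover have "y \<in> shift_space G"
    using cyl_subset_shift_space[OF assms(1)] y by blast
  moreover have "1 \<le> ulength (uconc \<delta> \<gamma>)" "P (first_edge (uconc \<delta> \<gamma>))"
    using assms(2,3) by (simp_all add: first_edge_uconc one_le_ulength_uconc)
  ultimately show "y \<in> {y \<in> shift_space G. \<exists>\<gamma>. y = uconc \<beta> \<gamma> \<and> 1 \<le> ulength \<gamma> \<and> P (first_edge \<gamma>)}"
    by blast
qed

lemma cyl_minus_append_subset:
  assumes "FinP (\<beta> @ \<delta>) A \<in> X_fin G" "\<delta> \<noteq> []" "P (hd \<delta>)"
  shows "cyl_minus G (\<beta> @ \<delta>) A F \<subseteq>
    {y \<in> shift_space G. \<exists>\<gamma>. y = uconc \<beta> \<gamma> \<and> 1 \<le> ulength \<gamma> \<and> P (first_edge \<gamma>)}"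
proof
  fix y assume y: "y \<in> cyl_minus G (\<beta> @ \<delta>) A F"
  then obtain \<gamma> where "y = uconc (\<beta> @ \<delta>) \<gamma>"
    unfolding cyl_minus_def by (force intro: that[of "FinP [] _"])
  then have "y = uconc \<beta> (uconc \<delta> \<gamma>)"
    by (simp add: uconc_append)
  moreover have "y \<in> shift_space G"
    using cyl_minus_subset_shift_space[OF assms(1)] y by blast
  moreover have "1 \<le> ulength (uconc \<delta> \<gamma>)" "P (first_edge (uconc \<delta> \<gamma>))"
    using assms(2,3) by (simp_all add: first_edge_uconc one_le_ulength_uconc)
  ultimately show "y \<in> {y \<in> shift_space G. \<exists>\<gamma>. y = uconc \<beta> \<gamma> \<and> 1 \<le> ulength \<gamma> \<and> P (first_edge \<gamma>)}"
    by blast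
qed

lemma basis_nhd_Inf_aux:
  assumes "infinite_path G x" "InfP x = uconc \<beta> \<gamma>" "P (first_edge \<gamma>)" "length \<beta> < n"
  shows "cyl G (map x [0..<n]) C \<subseteq>
    {y \<in> shift_space G. \<exists>\<gamma>. y = uconc \<beta> \<gamma> \<and> 1 \<le> ulength \<gamma> \<and> P (first_edge \<gamma>)}"
proof -
  obtain z where z: "\<gamma> = InfP z" and x: "x = conc \<beta> z"
    using assms(2) by (cases \<gamma>) auto
  define \<delta> where "\<delta> = map z [0..<n - length \<beta>]"
  have eq: "map x [0..<n] = \<beta> @ \<delta>"
    using assms(4) by (intro nth_equalityI) (auto simp: x \<delta>_def conc_def nth_append)
  have "\<delta> \<noteq> []" "hd \<delta> = z 0"
    using assms(4) by (auto simp: \<delta>_def hd_map)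
  then show ?thesis
    using cyl_append_subset[of G \<beta> \<delta> P C] finite_path_prefix[OF assms(1), of n] assms(3,4) z
    by (simp add: eq)
qed

lemma basis_nhd_Inf:
  fixes G :: "('v, 'e) ultragraph"
  assumes "D \<in> shift_basis G" "InfP x \<in> D"
  shows "\<exists>m. \<forall>n>m. cyl G (map x [0..<n]) (rng G (x (n - 1))) \<subseteq> D"
proof -
  have x: "infinite_path G x"
    using shift_basis_subset_shift_space[OF assms(1)] assms(2)
    by (auto simp: shift_space_def X_fin_def)
  from assms(1) consider
    (1) \<beta> B where "D = cyl G \<beta> B"
  | (2) \<beta> B F where "D = cyl_minus G \<beta> B F"
    unfolding shift_basis_def by auto
  then show ?thesis
  proof cases
    case 1
    have "\<exists>\<gamma> :: ('v, 'e) upath. InfP x = uconc \<beta> \<gamma> \<and> src G (first_edge \<gamma>) \<in> B"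
      using assms(2) by (auto simp: 1 cyl_def)
    then obtain \<gamma> :: "('v, 'e) upath" where "InfP x = uconc \<beta> \<gamma>" "src G (first_edge \<gamma>) \<in> B"
      by blast
    from basis_nhd_Inf_aux[where P = "\<lambda>a. src G a \<in> B", OF x this] show ?thesis
      unfolding 1 cyl_def[of G \<beta> B] by blast
  next
    case 2
    have "\<exists>\<gamma> :: ('v, 'e) upath. InfP x = uconc \<beta> \<gamma> \<and> first_edge \<gamma> \<in> emitted G B - F"
      using assms(2) by (auto simp: 2 cyl_minus_def)
    then obtain \<gamma> :: "('v, 'e) upath" where "InfP x = uconc \<beta> \<gamma>" "first_edge \<gamma> \<in> emitted G B - F"
      by blast
    from basis_nhd_Inf_aux[where P = "\<lambda>a. a \<in> emitted G B - F", OF x this] show ?thesis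
      unfolding 2 cyl_minus_def[of G \<beta> B F] by blast
  qed
qed

lemma basis_nhd_Fin:
  assumes "D \<in> shift_basis G" "FinP \<alpha> A \<in> D"
  shows "\<exists>F. finite F \<and> F \<subseteq> emitted G A \<and> cyl_minus G \<alpha> A F \<subseteq> D"
proof -
  have A: "FinP \<alpha> A \<in> X_fin G"
    using shift_basis_subset_shift_space[OF assms(1)] assms(2) by (auto simp: shift_space_def)
  have split: "\<exists>\<delta>. \<alpha> = \<beta> @ \<delta> \<and> \<delta> \<noteq> [] \<and> first_edge \<gamma> = hd \<delta>"
    if "FinP \<alpha> A = uconc \<beta> \<gamma>" "1 \<le> ulength \<gamma>" for \<beta> \<gamma>
    using that by (cases \<gamma>) (auto simp: one_enat_def)
  from assms(1) consider
    (1) \<beta> B where "D = cyl G \<beta> B"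
  | (2) \<beta> B F where "D = cyl_minus G \<beta> B F" "F \<subseteq> emitted G B" "finite F"
    unfolding shift_basis_def by auto
  then show ?thesis
  proof cases
    case 1
    from assms(2)[unfolded 1 cyl_def] consider "\<alpha> = \<beta>" "A \<subseteq> B" "A \<in> min_emitters_in_range G \<beta>"
      | \<gamma> where "FinP \<alpha> A = uconc \<beta> \<gamma>" "1 \<le> ulength \<gamma>" "src G (first_edge \<gamma>) \<in> B"
      by auto
    then show ?thesis
    proof cases
      case 1
      then have "cyl_minus G \<alpha> A {} \<subseteq> D"
        unfolding \<open>D = cyl G \<beta> B\<close> cyl_def cyl_minus_def emitted_def by auto
      then show ?thesis by blast
    next
      case 2
      then obtain \<delta> where "\<alpha> = \<beta> @ \<delta>" "\<delta> \<noteq> []" "src G (hd \<delta>) \<in> B"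
        using split by metis
      then have "cyl_minus G \<alpha> A {} \<subseteq> D"
        using cyl_minus_append_subset[where P = "\<lambda>a. src G a \<in> B"] A
        unfolding \<open>D = cyl G \<beta> B\<close> cyl_def[of G \<beta> B] by blast
      then show ?thesis by blast
    qed
  next
    case 2
    from assms(2)[unfolded 2 cyl_minus_def] consider "\<alpha> = \<beta>" "A = B"
      | \<gamma> where "FinP \<alpha> A = uconc \<beta> \<gamma>" "1 \<le> ulength \<gamma>" "first_edge \<gamma> \<in> emitted G B - F"
      by auto
    then show ?thesis
    proof cases
      case 1
      then show ?thesis using 2 by blast
    next
      case 2
      then obtain \<delta> where "\<alpha> = \<beta> @ \<delta>" "\<delta> \<noteq> []" "hd \<delta> \<in> emitted G B - F"
        using split by metis
      then have "cyl_minus G \<alpha> A {} \<subseteq> D"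
        using cyl_minus_append_subset[where P = "\<lambda>a. a \<in> emitted G B - F"] A
        unfolding \<open>D = cyl_minus G \<beta> B F\<close> cyl_minus_def[of G \<beta> B F] by blast
      then show ?thesis by blast
    qed
  qed
qed

lemma shift_basis_Int:
  assumes D: "D1 \<in> shift_basis G" "D2 \<in> shift_basis G" and p: "p \<in> D1" "p \<in> D2"
  shows "\<exists>D\<in>shift_basis G. p \<in> D \<and> D \<subseteq> D1 \<inter> D2"
proof (cases p)
  case (InfP x)
  then have x: "infinite_path G x"
    using shift_basis_subset_shift_space[OF D(1)] p(1) by (auto simp: shift_space_def X_fin_def)
  obtain m1 m2 where
    "\<forall>n>m1. cyl G (map x [0..<n]) (rng G (x (n - 1))) \<subseteq> D1"
    "\<forall>n>m2. cyl G (map x [0..<n]) (rng G (x (n - 1))) \<subseteq> D2"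
    using basis_nhd_Inf D p InfP by metis
  then have "cyl G (map x [0..<Suc (m1 + m2)]) (rng G (x (Suc (m1 + m2) - 1))) \<subseteq> D1 \<inter> D2"
    by (metis Int_greatest le_add1 le_add2 less_Suc_eq_le)
  then show ?thesis
    using cyl_prefix_in_basis[OF x, of "Suc (m1 + m2)"] InfP by blast
next
  case (FinP \<alpha> A)
  then have A: "FinP \<alpha> A \<in> X_fin G"
    using shift_basis_subset_shift_space[OF D(1)] p(1) by (auto simp: shift_space_def)
  obtain F1 F2 where F: "finite F1" "F1 \<subseteq> emitted G A" "cyl_minus G \<alpha> A F1 \<subseteq> D1"
    "finite F2" "F2 \<subseteq> emitted G A" "cyl_minus G \<alpha> A F2 \<subseteq> D2"
    using basis_nhd_Fin D p FinP by metis
  have "cyl_minus G \<alpha> A (F1 \<union> F2) \<subseteq> cyl_minus G \<alpha> A F1 \<inter> cyl_minus G \<alpha> A F2"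
    unfolding cyl_minus_def by blast
  moreover have "cyl_minus G \<alpha> A (F1 \<union> F2) \<in> shift_basis G"
    unfolding shift_basis_def using A F by blast
  moreover have "p \<in> cyl_minus G \<alpha> A (F1 \<union> F2)"
    unfolding FinP cyl_minus_def by blast
  moreover have "cyl_minus G \<alpha> A F1 \<inter> cyl_minus G \<alpha> A F2 \<subseteq> D1 \<inter> D2"
    using F(3,6) by (rule Int_mono)
  ultimately show ?thesis by (meson subset_trans)
qed

lemma openin_shift_topology_iff:
  "openin (shift_topology G) U \<longleftrightarrow> (\<forall>p\<in>U. \<exists>D\<in>shift_basis G. p \<in> D \<and> D \<subseteq> U)"
proof
  assume "openin (shift_topology G) U"
  then have "generate_topology_on (shift_basis G) U"
    by (simp add: shift_topology_def openin_topology_generated_by_iff)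
  then show "\<forall>p\<in>U. \<exists>D\<in>shift_basis G. p \<in> D \<and> D \<subseteq> U"
  proof induction
    case (Int a b)
    show ?case
    proof
      fix p assume "p \<in> a \<inter> b"
      then obtain D1 D2 where "D1 \<in> shift_basis G" "p \<in> D1" "D1 \<subseteq> a"
        "D2 \<in> shift_basis G" "p \<in> D2" "D2 \<subseteq> b"
        using Int.IH by blast
      then show "\<exists>D\<in>shift_basis G. p \<in> D \<and> D \<subseteq> a \<inter> b"
        using shift_basis_Int[of D1 G D2 p] by blast
    qed
  next
    case (UN K)
    show ?case
    proof
      fix p assume "p \<in> \<Union>K"
      then obtain k where k: "k \<in> K" "p \<in> k" by blast
      then obtain D where "D \<in> shift_basis G" "p \<in> D" "D \<subseteq> k"
        using UN.IH by meson
      then show "\<exists>D\<in>shift_basis G. p \<in> D \<and> D \<subseteq> \<Union>K"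
        using k(1) by (meson Union_upper subset_trans)
    qed
  qed auto
next
  assume *: "\<forall>p\<in>U. \<exists>D\<in>shift_basis G. p \<in> D \<and> D \<subseteq> U"
  show "openin (shift_topology G) U"
  proof (subst openin_subopen, intro ballI)
    fix p assume "p \<in> U"
    then obtain D where "D \<in> shift_basis G" "p \<in> D" "D \<subseteq> U"
      using * by blast
    moreover from this(1) have "openin (shift_topology G) D"
      unfolding shift_topology_def by (rule topology_generated_by_Basis)
    ultimately show "\<exists>V. openin (shift_topology G) V \<and> p \<in> V \<and> V \<subseteq> U"
      by blast
  qed
qed

lemma topspace_shift_topology: "topspace (shift_topology G) = shift_space G"
proof -
  have "\<exists>D\<in>shift_basis G. p \<in> D" if "p \<in> shift_space G" for p
  proof (cases p)
    case (InfP x)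
    then have "infinite_path G x"
      using that by (auto simp: shift_space_def X_fin_def)
    then show ?thesis using cyl_prefix_in_basis[of G x 1] InfP by auto
  next
    case (FinP \<alpha> A)
    then have "FinP \<alpha> A \<in> X_fin G"
      using that by (auto simp: shift_space_def)
    then have "cyl_minus G \<alpha> A {} \<in> shift_basis G"
      unfolding shift_basis_def by blast
    then show ?thesis unfolding FinP cyl_minus_def by blast
  qed
  then show ?thesis
    using shift_basis_subset_shift_space[of _ G]
    unfolding shift_topology_def topology_generated_by_topspace by blast
qed


section \<open>Topological entropy of a partially defined map\<close>

text \<open>A system is given by a topology \<open>T\<close>, a domain \<open>D \<subseteq> topspace T\<close> and a map \<open>f\<close>, of which only
  the restriction to \<open>D\<close> is relevant.\<close>

fun iter_dom :: "'a topology \<Rightarrow> 'a set \<Rightarrow> ('a \<Rightarrow> 'a) \<Rightarrow> nat \<Rightarrow> 'a set" where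
  "iter_dom T D f 0 = topspace T"
| "iter_dom T D f (Suc n) = {x \<in> D. f x \<in> iter_dom T D f n}"

definition iter_preimage ::
  "'a topology \<Rightarrow> 'a set \<Rightarrow> ('a \<Rightarrow> 'a) \<Rightarrow> nat \<Rightarrow> 'a set \<Rightarrow> 'a set" where
  "iter_preimage T D f i A = {x \<in> iter_dom T D f i. (f ^^ i) x \<in> A}"

definition join :: "'a set set \<Rightarrow> 'a set set \<Rightarrow> 'a set set" where
  "join \<alpha> \<beta> = {A \<inter> B |A B. A \<in> \<alpha> \<and> B \<in> \<beta>}"

fun iter_join ::
  "'a topology \<Rightarrow> 'a set \<Rightarrow> ('a \<Rightarrow> 'a) \<Rightarrow> 'a set set \<Rightarrow> nat \<Rightarrow> 'a set set" where
  "iter_join T D f \<alpha> 0 = \<alpha>"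
| "iter_join T D f \<alpha> (Suc n) =
     join (iter_join T D f \<alpha> n) (iter_preimage T D f (Suc n) ` \<alpha>)"

definition iter_inter ::
  "'a topology \<Rightarrow> 'a set \<Rightarrow> ('a \<Rightarrow> 'a) \<Rightarrow> 'a set \<Rightarrow> nat \<Rightarrow> 'a set" where
  "iter_inter T D f K n = (\<Inter>i\<le>n. iter_preimage T D f i K)"

text \<open>The least size of a finite subcover. In \<open>cover_entropy\<close> below, for compact \<open>K\<close>, a finite
  subcover always exists, obtained from a finite subcover of \<open>\<alpha>\<close> for \<open>K\<close>.\<close>

definition cover_number :: "'a set set \<Rightarrow> 'a set \<Rightarrow> nat" where
  "cover_number \<A> K =
     (if K = {} then 1 else LEAST m. \<exists>\<B>\<subseteq>\<A>. finite \<B> \<and> K \<subseteq> \<Union>\<B> \<and> card \<B> = m)"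

definition open_cover :: "'a topology \<Rightarrow> 'a set \<Rightarrow> 'a set set \<Rightarrow> bool" where
  "open_cover T K \<alpha> \<longleftrightarrow> (\<forall>U\<in>\<alpha>. openin T U) \<and> K \<subseteq> \<Union>\<alpha>"

definition cover_entropy ::
  "'a topology \<Rightarrow> 'a set \<Rightarrow> ('a \<Rightarrow> 'a) \<Rightarrow> 'a set set \<Rightarrow> 'a set \<Rightarrow> real" where
  "cover_entropy T D f \<alpha> K =
     lim (\<lambda>n. 1 / real n * ln (real (cover_number (iter_join T D f \<alpha> n) (iter_inter T D f K n))))"

definition compact_entropy ::
  "'a topology \<Rightarrow> 'a set \<Rightarrow> ('a \<Rightarrow> 'a) \<Rightarrow> 'a set \<Rightarrow> ereal" where
  "compact_entropy T D f K = (SUP \<alpha>\<in>{\<alpha>. open_cover T K \<alpha>}. ereal (cover_entropy T D f \<alpha> K))"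

definition topological_entropy :: "'a topology \<Rightarrow> 'a set \<Rightarrow> ('a \<Rightarrow> 'a) \<Rightarrow> ereal" where
  "topological_entropy T D f = (SUP K\<in>{K. compactin T K}. compact_entropy T D f K)"


section \<open>The Renewal shift ultragraph\<close>

datatype renewal_edge = Edge_e | Edge_f nat

text \<open>The vertex \<open>v\<^sub>i\<close> is the number \<open>i \<ge> 1\<close>.\<close>

definition renewal :: "(nat, renewal_edge) ultragraph" where
  "renewal =
     \<lparr>verts = {i. 1 \<le> i},
      edges = {Edge_e} \<union> {Edge_f i |i. 1 \<le> i},
      src = (\<lambda>a. case a of Edge_e \<Rightarrow> 1 | Edge_f i \<Rightarrow> i + 1),
      rng = (\<lambda>a. case a of Edge_e \<Rightarrow> {i. 1 \<le> i} | Edge_f i \<Rightarrow> {i})\<rparr>"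

lemma is_ultragraph_renewal: "is_ultragraph renewal"
  by (auto simp: is_ultragraph_def renewal_def setcompr_eq_image)

end

theory Submission
  imports Defs
begin

text \<open>Every edge of the renewal ultragraph other than \<open>e\<close> forces the path down to \<open>e\<close>, so a path is
  determined by the times at which it uses \<open>e\<close>. Sending a path to the indicator of these times
  (padded by zeros when the path is finite) identifies \<open>X\<close> with the Cantor space \<open>{0,1}\<^sup>\<nat>\<close>, the
  topology with the product topology, and \<open>\<sigma>\<close> with the full shift on two symbols, except that \<open>\<sigma>\<close>
  is undefined at the zero sequence. For a cover of a compact set with Lebesgue number \<open>m\<close>,
  the cylinders of length \<open>n + m\<close> refine the \<open>n\<close>-th join, so \<open>N \<le> 2\<^sup>n\<^sup>+\<^sup>m\<close>; for \<open>K = X\<close> and the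
  partition by the first symbol all \<open>2\<^sup>n\<^sup>+\<^sup>1\<close> words are realised by infinite paths.\<close>

section \<open>Subadditive sequences and cover numbers\<close>

text \<open>Fekete's lemma: the limit is the infimum of \<open>a n / n\<close> over
  \<open>n \<ge> 1\<close>, which is a real number because the sequence is bounded below by
  0.\<close>

lemma subadditive_convergent:
  fixes a :: "nat \<Rightarrow> real"
  assumes sub: "\<And>m n. a (m + n) \<le> a m + a n" and nonneg: "\<And>n. 0 \<le> a n"
  shows "convergent (\<lambda>n. a n / real n)"
proof -
  define L where "L = (INF n\<in>{1..}. a n / real n)"
  have bdd: "bdd_below ((\<lambda>n. a n / real n) ` {1..})"
    by (rule bdd_belowI2[of _ 0]) (simp add: nonneg)
  have mult: "a (q * k) \<le> a 0 + real q * a k" for q k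
  proof (induction q)
    case (Suc q)
    then show ?case using sub[of k "q * k"] by (simp add: algebra_simps)
  qed simp
  have "(\<lambda>n. a n / real n) \<longlonglongrightarrow> L"
  proof (rule order_tendstoI)
    fix y assume "y < L"
    have "y < a n / real n" if "n \<ge> 1" for n
      using cINF_lower[OF bdd, of n] that \<open>y < L\<close> by (simp add: L_def)
    then show "\<forall>\<^sub>F n in sequentially. y < a n / real n"
      using eventually_sequentially by blast
  next
    fix y assume "L < y"
    then obtain k where k: "k \<ge> 1" "a k / real k < y"
      unfolding L_def using cINF_less_iff[OF _ bdd] by auto
    \<comment> \<open>Division with remainder gives \<open>n = q * k + r\<close> with
      \<open>r < k\<close>. \<open>C\<close> bounds the leftover \<open>a 0 + a r\<close> for all
      \<open>r\<close> at once; the term \<open>a 0\<close> enters through \<open>mult\<close> at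
      \<open>q = 0\<close>.\<close>
    define C where "C = a 0 + (\<Sum>r<k. a r)"
    have le: "a n / real n \<le> a k / real k + C / real n" if "n \<ge> 1" for n
    proof -
      have "a 0 + a (n mod k) \<le> C"
        unfolding C_def using k(1) by (intro add_left_mono member_le_sum) (auto simp: nonneg)
      then have "a n \<le> real (n div k) * a k + C"
        using sub[of "n div k * k" "n mod k"] mult[of "n div k" k] by simp
      also have "real (n div k) * a k = real (n div k * k) * (a k / real k)"
        using k(1) by simp
      also have "\<dots> \<le> real n * (a k / real k)"
        by (intro mult_right_mono) (simp_all only: of_nat_le_iff, simp_all add: nonneg)
      finally show ?thesis using that by (simp add: field_simps)
    qed
    have "(\<lambda>n. a k / real k + C / real n) \<longlonglongrightarrow> a k / real k + 0"
      by (intro tendsto_intros lim_const_over_n)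
    then have "\<forall>\<^sub>F n in sequentially. a k / real k + C / real n < y"
      using k(2) by (intro order_tendstoD(2)) auto
    with eventually_ge_at_top[of 1] show "\<forall>\<^sub>F n in sequentially. a n / real n < y"
      by eventually_elim (use le in \<open>fastforce intro: le_less_trans\<close>)
  qed
  then show ?thesis by (rule convergentI)
qed

section \<open>Minimal subcovers\<close>

lemma cover_number_le:
  assumes "K \<noteq> {}" "\<B> \<subseteq> \<A>" "finite \<B>" "K \<subseteq> \<Union>\<B>"
  shows "cover_number \<A> K \<le> card \<B>"
  unfolding cover_number_def using assms by (auto intro!: Least_le)

lemma cover_number_attained:
  assumes "K \<noteq> {}" "\<exists>\<B>\<subseteq>\<A>. finite \<B> \<and> K \<subseteq> \<Union>\<B>"
  obtains \<B> where "\<B> \<subseteq> \<A>" "finite \<B>" "K \<subseteq> \<Union>\<B>" "card \<B> = cover_number \<A> K"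
proof -
  have "\<exists>m. \<exists>\<B>\<subseteq>\<A>. finite \<B> \<and> K \<subseteq> \<Union>\<B> \<and> card \<B> = m"
    using assms(2) by blast
  from LeastI_ex[OF this] show thesis
    using assms(1) that unfolding cover_number_def by auto
qed

text \<open>Positivity keeps the logarithms below nonnegative and lets \<open>ln\<close> be compared
  monotonically. The empty set has number 1 by convention.\<close>

lemma cover_number_ge_1:
  assumes "\<exists>\<B>\<subseteq>\<A>. finite \<B> \<and> K \<subseteq> \<Union>\<B>"
  shows "1 \<le> cover_number \<A> K"
proof (cases "K = {}")
  case False
  then obtain \<B> where "finite \<B>" "K \<subseteq> \<Union>\<B>" "card \<B> = cover_number \<A> K"
    using cover_number_attained[OF _ assms] by metis
  moreover from this have "\<B> \<noteq> {}" using False by auto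
  ultimately show ?thesis
    by (metis One_nat_def Suc_leI card_gt_0_iff)
qed (simp add: cover_number_def)


section \<open>Entropy of a partially defined map\<close>

context
  fixes T :: "'a topology" and D :: "'a set" and f :: "'a \<Rightarrow> 'a"
  assumes D: "D \<subseteq> topspace T"
begin

lemma iter_dom_subset_topspace: "iter_dom T D f n \<subseteq> topspace T"
  using D by (cases n) auto

lemma iter_dom_add: "iter_dom T D f (i + j) = {x \<in> iter_dom T D f i. (f ^^ i) x \<in> iter_dom T D f j}"
proof (induction i)
  case 0
  show ?case using iter_dom_subset_topspace by auto
next
  case (Suc i)
  then show ?case by (auto simp: funpow_swap1)
qed

lemma iter_preimage_add:
  "iter_preimage T D f (i + j) A = {x \<in> iter_dom T D f i. (f ^^ i) x \<in> iter_preimage T D f j A}"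
proof -
  have "(f ^^ (i + j)) x = (f ^^ j) ((f ^^ i) x)" for x
    by (metis add.commute comp_apply funpow_add)
  then show ?thesis
    by (auto simp: iter_preimage_def iter_dom_add)
qed

lemma iter_inter_iff: "x \<in> iter_inter T D f K n \<longleftrightarrow> (\<forall>i\<le>n. x \<in> iter_preimage T D f i K)"
  by (auto simp: iter_inter_def)

text \<open>Members of the join are indexed by itineraries \<open>u\<close>, which can be restricted
  and concatenated. The hypothesis serves time 0: the join starts with \<alpha> itself, while
  \<open>iter_preimage\<close> at 0 intersects with the space.\<close>

lemma iter_join_iff:
  assumes "\<alpha> \<subseteq> Pow (topspace T)"
  shows "A \<in> iter_join T D f \<alpha> n \<longleftrightarrow>
    (\<exists>u. (\<forall>i\<le>n. u i \<in> \<alpha>) \<and> A = (\<Inter>i\<le>n. iter_preimage T D f i (u i)))"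
proof (induction n arbitrary: A)
  case 0
  have eq: "iter_preimage T D f 0 U = U" if "U \<in> \<alpha>" for U
    using assms that by (auto simp: iter_preimage_def)
  show ?case
  proof
    assume "A \<in> iter_join T D f \<alpha> 0"
    then show "\<exists>u. (\<forall>i\<le>0. u i \<in> \<alpha>) \<and> A = (\<Inter>i\<le>0. iter_preimage T D f i (u i))"
      using eq by (intro exI[of _ "\<lambda>_. A"]) auto
  qed (use eq in auto)
next
  case (Suc n)
  show ?case
  proof
    assume "A \<in> iter_join T D f \<alpha> (Suc n)"
    then obtain B V where A: "A = B \<inter> iter_preimage T D f (Suc n) V" "B \<in> iter_join T D f \<alpha> n" "V \<in> \<alpha>"
      by (auto simp: join_def)
    then obtain u where u: "\<forall>i\<le>n. u i \<in> \<alpha>" "B = (\<Inter>i\<le>n. iter_preimage T D f i (u i))"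
      using Suc.IH by blast
    show "\<exists>u. (\<forall>i\<le>Suc n. u i \<in> \<alpha>) \<and> A = (\<Inter>i\<le>Suc n. iter_preimage T D f i (u i))"
      using A u by (intro exI[of _ "u(Suc n := V)"]) (auto simp: atMost_Suc le_Suc_eq)
  next
    assume "\<exists>u. (\<forall>i\<le>Suc n. u i \<in> \<alpha>) \<and> A = (\<Inter>i\<le>Suc n. iter_preimage T D f i (u i))"
    then obtain u where u: "\<forall>i\<le>Suc n. u i \<in> \<alpha>" "A = (\<Inter>i\<le>Suc n. iter_preimage T D f i (u i))"
      by blast
    then have "(\<Inter>i\<le>n. iter_preimage T D f i (u i)) \<in> iter_join T D f \<alpha> n"
      unfolding Suc.IH by (intro exI[of _ u] conjI) simp_all
    then show "A \<in> iter_join T D f \<alpha> (Suc n)"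
      using u by (auto simp: join_def atMost_Suc)
  qed
qed

context
  fixes \<alpha> \<F> :: "'a set set" and K :: "'a set"
  assumes \<alpha>: "\<alpha> \<subseteq> Pow (topspace T)"
    and \<F>: "finite \<F>" "\<F> \<subseteq> \<alpha>" "K \<subseteq> \<Union>\<F>"
begin

text \<open>The witness is the \<open>n\<close>-th join of the finite subcover \<F>: a finite number
  of itineraries, one of which every orbit staying in \<open>K\<close> follows. It makes the
  \<open>LEAST\<close> in \<open>cover_number\<close> a genuine minimum.\<close>

lemma iter_join_finite_subcover:
  "\<exists>\<B>\<subseteq>iter_join T D f \<alpha> n. finite \<B> \<and> iter_inter T D f K n \<subseteq> \<Union>\<B>"
proof (intro exI conjI)
  have *: "\<F> \<subseteq> Pow (topspace T)"
    using \<alpha> \<F> by blast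
  show "iter_join T D f \<F> n \<subseteq> iter_join T D f \<alpha> n"
    using \<F>(2) by (auto simp: iter_join_iff[OF *] iter_join_iff[OF \<alpha>]) blast
  show "finite (iter_join T D f \<F> n)"
  proof (induction n)
    case (Suc n)
    have "iter_join T D f \<F> (Suc n) =
        (\<lambda>(A, B). A \<inter> B) ` (iter_join T D f \<F> n \<times> iter_preimage T D f (Suc n) ` \<F>)"
      by (auto simp: join_def)
    then show ?case using Suc \<F>(1) by simp
  qed (simp add: \<F>)
  show "iter_inter T D f K n \<subseteq> \<Union>(iter_join T D f \<F> n)"
  proof
    fix x assume x: "x \<in> iter_inter T D f K n"
    then have "\<forall>i\<in>{..n}. \<exists>U\<in>\<F>. (f ^^ i) x \<in> U"
      using \<F>(3) by (fastforce simp: iter_inter_def iter_preimage_def)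
    then obtain u where u: "\<forall>i\<in>{..n}. u i \<in> \<F> \<and> (f ^^ i) x \<in> u i"
      by metis
    have "(\<Inter>i\<le>n. iter_preimage T D f i (u i)) \<in> iter_join T D f \<F> n"
      unfolding iter_join_iff[OF *] by (rule exI[of _ u]) (simp add: u)
    moreover have "x \<in> (\<Inter>i\<le>n. iter_preimage T D f i (u i))"
      using u x by (simp add: iter_inter_def iter_preimage_def)
    ultimately show "x \<in> \<Union>(iter_join T D f \<F> n)" by blast
  qed
qed

text \<open>An orbit segment over times 0 to \<open>m + 1 + n\<close> splits into times 0 to
  \<open>m\<close> and times \<open>m + 1\<close> to \<open>m + 1 + n\<close>. The extra 1 arises
  because the \<open>n\<close>-th join looks at \<open>n + 1\<close> times.\<close>

lemma cover_number_submultiplicative: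
  "cover_number (iter_join T D f \<alpha> (Suc m + n)) (iter_inter T D f K (Suc m + n)) \<le>
   cover_number (iter_join T D f \<alpha> m) (iter_inter T D f K m) *
   cover_number (iter_join T D f \<alpha> n) (iter_inter T D f K n)"
  (is "?N (Suc m + n) \<le> ?N m * ?N n")
proof (cases "iter_inter T D f K (Suc m + n) = {}")
  case True
  then show ?thesis
    using cover_number_ge_1[OF iter_join_finite_subcover[of m]]
      cover_number_ge_1[OF iter_join_finite_subcover[of n]]
    by (simp add: cover_number_def[of _ "{}"] Suc_le_eq)
next
  case False
  have fst: "x \<in> iter_inter T D f K m" if "x \<in> iter_inter T D f K (Suc m + n)" for x
    using that by (simp add: iter_inter_iff)
  have snd: "x \<in> iter_dom T D f (Suc m)" "(f ^^ Suc m) x \<in> iter_inter T D f K n"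
    if x: "x \<in> iter_inter T D f K (Suc m + n)" for x
  proof -
    have *: "x \<in> iter_dom T D f (Suc m) \<and> (f ^^ Suc m) x \<in> iter_preimage T D f i K" if "i \<le> n" for i
    proof -
      have "x \<in> iter_preimage T D f (Suc m + i) K"
        using x that by (simp add: iter_inter_iff)
      then show ?thesis unfolding iter_preimage_add by blast
    qed
    show "x \<in> iter_dom T D f (Suc m)" using *[of 0] by blast
    show "(f ^^ Suc m) x \<in> iter_inter T D f K n" using * by (simp add: iter_inter_iff)
  qed
  obtain \<B> where \<B>: "\<B> \<subseteq> iter_join T D f \<alpha> m" "finite \<B>" "iter_inter T D f K m \<subseteq> \<Union>\<B>" "card \<B> = ?N m"
    using cover_number_attained[OF _ iter_join_finite_subcover[of m]] fst False
    by (metis equals0D ex_in_conv)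
  obtain \<C> where \<C>: "\<C> \<subseteq> iter_join T D f \<alpha> n" "finite \<C>" "iter_inter T D f K n \<subseteq> \<Union>\<C>" "card \<C> = ?N n"
    using cover_number_attained[OF _ iter_join_finite_subcover[of n]] snd(2) False
    by (metis equals0D ex_in_conv)
  \<comment> \<open>Gluing two subcovers: follow \<open>B\<close> up to time \<open>m\<close>, then
    \<open>C\<close> from time \<open>m + 1\<close>. The glued itinerary is \<open>w\<close>
    below.\<close>
  define g where "g = (\<lambda>(B, C). B \<inter> iter_preimage T D f (Suc m) C)"
  have "g (B, C) \<in> iter_join T D f \<alpha> (Suc m + n)" if BC: "B \<in> \<B>" "C \<in> \<C>" for B C
  proof -
    obtain u where u: "\<forall>i\<le>m. u i \<in> \<alpha>" "B = (\<Inter>i\<le>m. iter_preimage T D f i (u i))"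
      using subsetD[OF \<B>(1) BC(1)] unfolding iter_join_iff[OF \<alpha>] by blast
    obtain v where v: "\<forall>i\<le>n. v i \<in> \<alpha>" "C = (\<Inter>i\<le>n. iter_preimage T D f i (v i))"
      using subsetD[OF \<C>(1) BC(2)] unfolding iter_join_iff[OF \<alpha>] by blast
    define w where "w i = (if i \<le> m then u i else v (i - Suc m))" for i
    have idx: "{..Suc m + n} = {..m} \<union> (+) (Suc m) ` {..n}"
      using image_add_atLeastAtMost[of "Suc m" 0 n] by (auto simp: atLeast0AtMost simp del: image_add_atLeastAtMost)
    have C: "iter_preimage T D f (Suc m) C = (\<Inter>i\<le>n. iter_preimage T D f (Suc m + i) (v i))"
    proof -
      have CT: "C \<subseteq> topspace T"
        using v(2) iter_dom_subset_topspace by (auto simp: iter_preimage_def)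
      have "iter_preimage T D f (Suc m) C = {x \<in> iter_dom T D f (Suc m). (f ^^ Suc m) x \<in> C}"
        by (simp add: iter_preimage_def)
      then show ?thesis unfolding v(2) iter_preimage_add by auto
    qed
    have "g (B, C) = (\<Inter>i\<le>Suc m + n. iter_preimage T D f i (w i))"
      unfolding idx g_def INF_union image_image by (simp add: C u(2) w_def)
    moreover have "\<forall>i\<le>Suc m + n. w i \<in> \<alpha>"
      using u(1) v(1) by (auto simp: w_def)
    ultimately show ?thesis unfolding iter_join_iff[OF \<alpha>] by blast
  qed
  then have "g ` (\<B> \<times> \<C>) \<subseteq> iter_join T D f \<alpha> (Suc m + n)" by auto
  moreover have "iter_inter T D f K (Suc m + n) \<subseteq> \<Union>(g ` (\<B> \<times> \<C>))"
  proof
    fix x assume x: "x \<in> iter_inter T D f K (Suc m + n)"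
    obtain B where "B \<in> \<B>" "x \<in> B"
      using subsetD[OF \<B>(3) fst[OF x]] by blast
    moreover obtain C where "C \<in> \<C>" "(f ^^ Suc m) x \<in> C"
      using subsetD[OF \<C>(3) snd(2)[OF x]] by blast
    ultimately have "x \<in> g (B, C)" "(B, C) \<in> \<B> \<times> \<C>"
      using snd(1)[OF x] by (auto simp: g_def iter_preimage_def)
    then show "x \<in> \<Union>(g ` (\<B> \<times> \<C>))" by blast
  qed
  ultimately have "?N (Suc m + n) \<le> card (g ` (\<B> \<times> \<C>))"
    using False \<B>(2) \<C>(2) by (intro cover_number_le) auto
  also have "\<dots> \<le> ?N m * ?N n"
    using card_image_le[of "\<B> \<times> \<C>" g] \<B> \<C> by (simp add: card_cartesian_product)
  finally show ?thesis .
qed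

text \<open>\<open>cover_entropy\<close> is a \<open>lim\<close>, which carries information only
  once convergence is known.\<close>

lemma cover_entropy_LIMSEQ:
  "(\<lambda>n. 1 / real n * ln (real (cover_number (iter_join T D f \<alpha> n) (iter_inter T D f K n))))
     \<longlonglongrightarrow> cover_entropy T D f \<alpha> K"
proof -
  define N where "N n = cover_number (iter_join T D f \<alpha> n) (iter_inter T D f K n)" for n
  \<comment> \<open>Indexing by the number of times observed, \<open>k + 1\<close> for
    \<open>N k\<close>, turns submultiplicativity into exact subadditivity.\<close>
  define a where "a n = (case n of 0 \<Rightarrow> 0 | Suc k \<Rightarrow> ln (real (N k)))" for n
  have N1: "1 \<le> N n" for n
    unfolding N_def by (rule cover_number_ge_1[OF iter_join_finite_subcover])
  have "a (m + n) \<le> a m + a n" for m n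
  proof (cases m; cases n)
    fix m' n' assume mn: "m = Suc m'" "n = Suc n'"
    have "real (N (Suc m' + n')) \<le> real (N m') * real (N n')"
      using cover_number_submultiplicative[of m' n'] unfolding N_def by (metis of_nat_le_iff of_nat_mult)
    then have "ln (real (N (Suc m' + n'))) \<le> ln (real (N m') * real (N n'))"
      using N1[of "Suc m' + n'"] by (subst ln_le_cancel_iff) (auto intro: less_le_trans)
    also have "\<dots> = ln (real (N m')) + ln (real (N n'))"
      using N1[of m'] N1[of n'] by (intro ln_mult_pos) auto
    finally show ?thesis by (simp add: mn a_def)
  qed (simp_all add: a_def)
  moreover have "0 \<le> a n" for n
    using N1 by (auto simp: a_def split: nat.split)
  ultimately obtain L where "(\<lambda>n. a n / real n) \<longlonglongrightarrow> L"
    using subadditive_convergent[of a] unfolding convergent_def by blast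
  \<comment> \<open>The factor \<open>(n + 1) / n\<close>, tending to 1, changes the normalisation
    from \<open>n + 1\<close> to the \<open>n\<close> of the definition.\<close>
  then have "(\<lambda>n. a (Suc n) / real (Suc n) * (real (Suc n) / real n)) \<longlonglongrightarrow> L * 1"
    by (intro tendsto_mult LIMSEQ_Suc[of "\<lambda>n. a n / real n"] LIMSEQ_Suc_n_over_n)
  then have "(\<lambda>n. 1 / real n * ln (real (N n))) \<longlonglongrightarrow> L"
    by (simp add: a_def del: of_nat_Suc)
  then show ?thesis
    unfolding N_def cover_entropy_def by (simp add: limI)
qed

end

end


section \<open>The shift space of the renewal ultragraph\<close>

lemma edges_renewal: "a \<in> edges renewal \<longleftrightarrow> (\<forall>k. a = Edge_f k \<longrightarrow> 1 \<le> k)"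
  by (cases a) (auto simp: renewal_def)

lemma src_renewal [simp]: "src renewal Edge_e = 1" "src renewal (Edge_f k) = Suc k"
  by (simp_all add: renewal_def)

lemma rng_renewal [simp]: "rng renewal Edge_e = {1..}" "rng renewal (Edge_f k) = {k}"
  by (auto simp: renewal_def)

lemma src_renewal_ge_1 [simp]: "Suc 0 \<le> src renewal a"
  by (cases a) auto

lemma emitted_renewal_all: "emitted renewal {1..} = edges renewal"
  by (auto simp: emitted_def)

text \<open>Being finite or everything is an invariant of the generating operations, since each
  range is a singleton or the whole vertex set.\<close>

lemma gverts_renewal:
  assumes "A \<in> gverts renewal" shows "A \<subseteq> {1..} \<and> (finite A \<or> A = {1..})"
  using assms
proof induction
  case (range a)
  then show ?case by (cases a) (auto simp: edges_renewal)
qed (auto simp: renewal_def)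

text \<open>Every vertex emits exactly one edge (\<open>v_1\<close> emits e, \<open>v_(k+1)\<close>
  emits \<open>f_k\<close>), so finite vertex sets emit finitely many edges and only the full set
  remains.\<close>

lemma infinite_emitter_renewal: "infinite_emitter renewal A \<longleftrightarrow> A = {1..}"
proof
  have "finite (emitted renewal A)" if "finite A"
  proof (rule finite_subset)
    show "emitted renewal A \<subseteq> insert Edge_e (Edge_f ` ((\<lambda>i. i - 1) ` A))"
    proof
      fix a assume "a \<in> emitted renewal A"
      then show "a \<in> insert Edge_e (Edge_f ` ((\<lambda>i. i - 1) ` A))"
        by (cases a) (force simp: emitted_def)+
    qed
  qed (use that in auto)
  then show "A = {1..}" if "infinite_emitter renewal A"
    using that gverts_renewal by (auto simp: infinite_emitter_def)
  have "infinite (Edge_f ` {1..})"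
    by (subst finite_image_iff) (auto simp: inj_on_def infinite_Ici)
  moreover have "Edge_f ` {1..} \<subseteq> edges renewal"
    by (auto simp: edges_renewal)
  ultimately have "infinite (edges renewal)"
    by (meson finite_subset)
  moreover have "{1..} \<in> gverts renewal"
    using gverts.range[of Edge_e renewal] by (simp add: edges_renewal)
  ultimately show "infinite_emitter renewal A" if "A = {1..}"
    using that emitted_renewal_all by (simp add: infinite_emitter_def)
qed

lemma min_infinite_emitter_renewal: "min_infinite_emitter renewal A \<longleftrightarrow> A = {1..}"
  by (auto simp: min_infinite_emitter_def infinite_emitter_renewal)

lemma min_emitters_in_range_renewal:
  "A \<in> min_emitters_in_range renewal \<alpha> \<longleftrightarrow> A = {1..} \<and> last \<alpha> = Edge_e"
proof -
  have "\<not> {1::nat..} \<subseteq> {k}" for k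
    by (metis finite.emptyI finite_insert finite_subset infinite_Ici)
  then show ?thesis
    by (cases "last \<alpha>") (auto simp: min_emitters_in_range_def path_rng_def min_infinite_emitter_renewal)
qed

lemma FinP_in_X_fin_renewal:
  "FinP \<alpha> A \<in> X_fin renewal \<longleftrightarrow>
     A = {1..} \<and> (\<alpha> = [] \<or> finite_path renewal \<alpha> \<and> last \<alpha> = Edge_e)"
  by (auto simp: X_fin_def min_emitters_in_range_renewal min_infinite_emitter_renewal finite_path_def)

lemma FinP_in_shift_space_renewal:
  "FinP \<alpha> A \<in> shift_space renewal \<longleftrightarrow>
     A = {1..} \<and> (\<alpha> = [] \<or> finite_path renewal \<alpha> \<and> last \<alpha> = Edge_e)"
  using FinP_in_X_fin_renewal[of \<alpha> A] by (auto simp: shift_space_def)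

lemma InfP_in_shift_space: "InfP x \<in> shift_space G \<longleftrightarrow> infinite_path G x"
  by (auto simp: shift_space_def X_fin_def)

text \<open>\<open>edge_at p t\<close> is a junk value when \<open>t\<close> is not below the length of \<open>p\<close>.\<close>

fun edge_at :: "('v, 'e) upath \<Rightarrow> nat \<Rightarrow> 'e" where
  "edge_at (FinP \<alpha> A) t = \<alpha> ! t"
| "edge_at (InfP x) t = x t"

text \<open>The length guard masks the junk values of \<open>edge_at\<close> and supplies the
  padding by zeros.\<close>

definition code :: "('v, renewal_edge) upath \<Rightarrow> nat \<Rightarrow> bool" where
  "code p t \<longleftrightarrow> enat t < ulength p \<and> edge_at p t = Edge_e"

text \<open>This includes length-zero paths: there the dummy value of \<open>shift\<close> is the
  path itself, whose code is identically false.\<close>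

lemma code_shift: "code (shift p) t = code p (Suc t)"
  by (cases p) (auto simp: code_def nth_tl)

lemma code_shift_funpow: "code ((shift ^^ i) p) t = code p (i + t)"
  by (induction i arbitrary: t) (simp_all add: code_shift)

lemma code_uconc:
  "code (uconc \<beta> \<gamma>) t \<longleftrightarrow> (if t < length \<beta> then \<beta> ! t = Edge_e else code \<gamma> (t - length \<beta>))"
  by (cases \<gamma>) (auto simp: code_def nth_append conc_def)

lemma edge_at_uconc_length: "1 \<le> ulength \<gamma> \<Longrightarrow> edge_at (uconc \<beta> \<gamma>) (length \<beta>) = first_edge \<gamma>"
  by (cases \<gamma>) (auto simp: nth_append conc_def one_enat_def Suc_le_eq intro: hd_conv_nth[symmetric])

text \<open>Turns coordinatewise agreement into a factorisation by \<open>uconc\<close>, the form in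
  which basic open sets are defined.\<close>

lemma upath_prefixE:
  assumes "\<And>t. t < length \<beta> \<Longrightarrow> enat t < ulength q \<and> edge_at q t = \<beta> ! t"
  obtains \<gamma> where "q = uconc \<beta> \<gamma>"
proof (cases q)
  case (FinP \<alpha> A)
  have "length \<beta> \<le> length \<alpha>"
    using assms[of "length \<beta> - 1"] FinP by (cases \<beta>) auto
  then have "take (length \<beta>) \<alpha> = \<beta>"
    using assms FinP by (intro nth_equalityI) auto
  then have "q = uconc \<beta> (FinP (drop (length \<beta>) \<alpha>) A)"
    by (metis FinP append_take_drop_id uconc.simps(1))
  then show thesis by (rule that)
next
  case (InfP x)
  then have "q = uconc \<beta> (InfP (\<lambda>i. x (length \<beta> + i)))"
    using assms by (auto simp: conc_def)
  then show thesis by (rule that)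
qed

section \<open>Recovering a path from its code\<close>

lemma edge_at_in_edges:
  assumes "p \<in> shift_space renewal" "enat t < ulength p"
  shows "edge_at p t \<in> edges renewal"
  using assms
  by (cases p) (auto simp: FinP_in_shift_space_renewal InfP_in_shift_space finite_path_def infinite_path_def)

text \<open>A path cannot stop after \<open>f_k\<close>, because finite points of positive length
  end in e; and \<open>v_k\<close>, the only vertex in the range of \<open>f_k\<close>, is the
  source of just one edge.\<close>

lemma edge_at_step:
  assumes p: "p \<in> shift_space renewal" "enat t < ulength p" "edge_at p t = Edge_f k"
  shows "enat (Suc t) < ulength p \<and> edge_at p (Suc t) = (if k = 1 then Edge_e else Edge_f (k - 1))"
proof -
  have src: "src renewal a = k \<Longrightarrow> a = (if k = 1 then Edge_e else Edge_f (k - 1))"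
    if "a \<in> edges renewal" for a
    using that by (cases a) (auto simp: edges_renewal)
  have len: "enat (Suc t) < ulength p"
  proof (cases p)
    case (FinP \<alpha> A)
    then have "t \<noteq> length \<alpha> - 1"
      using p by (auto simp: FinP_in_shift_space_renewal finite_path_def last_conv_nth)
    then show ?thesis using FinP p(2) by auto
  qed simp
  moreover have "src renewal (edge_at p (Suc t)) \<in> rng renewal (edge_at p t)"
    using p(1) len
    by (cases p) (auto simp: FinP_in_shift_space_renewal InfP_in_shift_space finite_path_def infinite_path_def)
  ultimately show ?thesis
    using src[OF edge_at_in_edges[OF p(1) len]] p(3) by simp
qed

text \<open>Induction on the index: each step lowers it by one until \<open>f_1\<close> is followed
  by e. Index 0 cannot occur, as \<open>f_0\<close> is not an edge.\<close>

lemma code_after_Edge_f: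
  assumes "p \<in> shift_space renewal" "enat t < ulength p" "edge_at p t = Edge_f k"
  shows "(\<forall>j<k. \<not> code p (t + j)) \<and> code p (t + k)"
  using assms
proof (induction k arbitrary: t)
  case 0
  then show ?case using edge_at_in_edges[of p t] by (force simp: edges_renewal)
next
  case (Suc k)
  have step: "enat (Suc t) < ulength p"
    "edge_at p (Suc t) = (if Suc k = 1 then Edge_e else Edge_f k)"
    using edge_at_step[OF Suc.prems] by auto
  have "\<not> code p t" using Suc.prems by (simp add: code_def)
  moreover have "(\<forall>j<k. \<not> code p (Suc t + j)) \<and> code p (Suc t + k)"
  proof (cases "k = 0")
    case True
    then show ?thesis using step by (simp add: code_def)
  next
    case False
    then show ?thesis using Suc.IH[of "Suc t"] step Suc.prems(1) by simp
  qed
  ultimately show ?case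
    by (auto simp: less_Suc_eq_0_disj)
qed

text \<open>After \<open>f\<^sub>k\<close> a path is forced through \<open>f\<^sub>k\<^sub>-\<^sub>1, \<dots>, f\<^sub>1\<close> to \<open>e\<close>, so the index \<open>k\<close> is
  the waiting time for the next \<open>e\<close>. The value is junk if \<open>b\<close> is false from \<open>t\<close> on.\<close>

definition next_edge :: "(nat \<Rightarrow> bool) \<Rightarrow> nat \<Rightarrow> renewal_edge" where
  "next_edge b t = (if b t then Edge_e else Edge_f (LEAST k. b (t + k)))"

lemma next_edge_eqI:
  assumes "b (t + k)" "\<And>j. j < k \<Longrightarrow> \<not> b (t + j)"
  shows "next_edge b t = (if k = 0 then Edge_e else Edge_f k)"
proof -
  have "(LEAST k. b (t + k)) = k"
    using assms by (intro Least_equality) (auto simp: not_less[symmetric])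
  then show ?thesis
    using assms(1) assms(2)[of 0] by (cases k) (auto simp: next_edge_def)
qed

lemma edge_at_eq_next_edge:
  assumes "p \<in> shift_space renewal" "enat t < ulength p"
  shows "edge_at p t = next_edge (code p) t"
proof (cases "edge_at p t")
  case Edge_e
  then show ?thesis using assms by (simp add: next_edge_def code_def)
next
  case (Edge_f k)
  with edge_at_in_edges[OF assms] have "k \<noteq> 0" by (auto simp: edges_renewal)
  then show ?thesis
    using code_after_Edge_f[OF assms Edge_f] next_edge_eqI[of "code p" t k] Edge_f by simp
qed

text \<open>\<open>next_edge\<close> looks into the future, but a 1 at position \<open>n - 1\<close>
  ends the wait before \<open>n\<close>, so the first \<open>n\<close> symbols decide it.\<close>

lemma next_edge_cong:
  assumes "t < n" "b (n - 1)" "\<And>i. i < n \<Longrightarrow> b i = c i"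
  shows "next_edge b t = next_edge c t"
proof -
  define k where "k = (LEAST k. b (t + k))"
  have ex: "b (t + (n - 1 - t))" using assms by simp
  have k: "b (t + k)" unfolding k_def using ex by (rule LeastI)
  have kn: "k \<le> n - 1 - t" unfolding k_def by (rule Least_le) (rule ex)
  have less: "\<not> b (t + j)" if "j < k" for j
    using not_less_Least[of j "\<lambda>k. b (t + k)"] that by (simp add: k_def)
  have "next_edge b t = (if k = 0 then Edge_e else Edge_f k)"
    using k less by (rule next_edge_eqI)
  moreover have "next_edge c t = (if k = 0 then Edge_e else Edge_f k)"
  proof (rule next_edge_eqI)
    show "c (t + k)" using assms(1) assms(3)[of "t + k"] k kn by auto
    show "\<not> c (t + j)" if "j < k" for j
      using assms(1) assms(3)[of "t + j"] less[OF that] that kn by auto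
  qed
  ultimately show ?thesis by simp
qed

lemma code_imp_less_ulength: "code p t \<Longrightarrow> s \<le> t \<Longrightarrow> enat s < ulength p"
  unfolding code_def by (meson enat_ord_simps(1) order_le_less_trans)

text \<open>Code prefixes determine edge prefixes only when they end in a 1; this is why cylinders
  are later cut at an occurrence of e.\<close>

lemma edge_at_cong:
  assumes "p \<in> shift_space renewal" "q \<in> shift_space renewal" "\<And>i. i < n \<Longrightarrow> code q i = code p i"
    and "code p (n - 1)" "t < n"
  shows "enat t < ulength q \<and> edge_at q t = edge_at p t"
proof -
  have "code q (n - 1)" using assms(3-5) by simp
  then have "enat t < ulength p" "enat t < ulength q"
    using assms(4,5) by (auto intro: code_imp_less_ulength)
  then show ?thesis
    using edge_at_eq_next_edge assms next_edge_cong[of t n "code p" "code q"] by metis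
qed

text \<open>Infinitely many ones give an infinite path, no ones the length-zero path, and otherwise
  the path is cut right after the last 1, so that it ends in e as finite points must.\<close>

lemma code_surj: "\<exists>p\<in>shift_space renewal. code p = b"
proof -
  have edge: "next_edge b t \<in> edges renewal" if "b (t + k)" for t k
    using LeastI[where P = "\<lambda>k. b (t + k)", OF that] by (cases "LEAST k. b (t + k)") (auto simp: next_edge_def edges_renewal)
  have step: "src renewal (next_edge b (Suc t)) \<in> rng renewal (next_edge b t)"
    if "b (Suc t + k)" for t k
  proof (cases "b t")
    case True
    then show ?thesis by (simp add: next_edge_def)
  next
    case False
    \<comment> \<open>\<open>l\<close> is the waiting time at \<open>t + 1\<close>, so the wait at
      \<open>t\<close> is \<open>l + 1\<close>; the edge at \<open>t + 1\<close> then starts at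
      \<open>v_(l+1)\<close>, the range of \<open>f_(l+1)\<close>.\<close>
    define l where "l = (LEAST k. b (Suc t + k))"
    have l: "b (Suc t + l)" "\<And>j. j < l \<Longrightarrow> \<not> b (Suc t + j)"
      unfolding l_def using LeastI[where P = "\<lambda>k. b (Suc t + k)", OF that] not_less_Least by blast+
    then have "next_edge b (Suc t) = (if l = 0 then Edge_e else Edge_f l)"
      by (rule next_edge_eqI)
    moreover have "next_edge b t = Edge_f (Suc l)"
    proof -
      have "\<not> b (t + j)" if "j < Suc l" for j
        using l(2) False that by (cases j) auto
      then show ?thesis
        using next_edge_eqI[of b t "Suc l"] l(1) by simp
    qed
    ultimately show ?thesis by simp
  qed
  show ?thesis
  proof (cases "finite {t. b t}")
    case False
    then have "\<exists>k. b (t + k)" for t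
      unfolding infinite_nat_iff_unbounded_le by (metis le_iff_add mem_Collect_eq)
    then have "infinite_path renewal (next_edge b)"
      unfolding infinite_path_def using edge step by metis
    moreover have "code (InfP (next_edge b)) = b"
      by (auto simp: code_def next_edge_def fun_eq_iff)
    ultimately show ?thesis by (metis InfP_in_shift_space)
  next
    case True
    show ?thesis
    proof (cases "{t. b t} = {}")
      case True
      then have "code (FinP [] {1..}) = b" by (auto simp: code_def)
      then show ?thesis by (auto simp: FinP_in_shift_space_renewal)
    next
      case False
      define N where "N = Max {t. b t}"
      have N: "b N" "\<And>t. b t \<Longrightarrow> t \<le> N"
        using Max_in[OF True False] Max_ge[OF True] by (auto simp: N_def)
      then have bN: "b (t + (N - t))" if "t \<le> N" for t using that by simp
      let ?\<alpha> = "map (next_edge b) [0..<Suc N]"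
      have "finite_path renewal ?\<alpha>"
        unfolding finite_path_def
      proof (intro conjI allI impI)
        show "set ?\<alpha> \<subseteq> edges renewal" using edge[OF bN] by auto
        show "src renewal (?\<alpha> ! Suc i) \<in> rng renewal (?\<alpha> ! i)" if "Suc i < length ?\<alpha>" for i
          using step[OF bN, of i] that by (simp del: upt_Suc)
      qed auto
      moreover have "last ?\<alpha> = Edge_e" using N(1) by (simp add: next_edge_def)
      moreover have "code (FinP ?\<alpha> A) = b" for A :: "nat set"
        using N(2) by (auto simp: code_def fun_eq_iff next_edge_def less_Suc_eq_le simp del: upt_Suc split: if_splits)
      ultimately show ?thesis
        by (intro bexI[of _ "FinP ?\<alpha> {1..}"]) (simp_all only: FinP_in_shift_space_renewal simp_thms)
    qed
  qed
qed


section \<open>The topology in terms of codes\<close>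

definition code_cylinder :: "(nat \<Rightarrow> bool) \<Rightarrow> nat \<Rightarrow> (nat, renewal_edge) upath set" where
  "code_cylinder b m = {q \<in> shift_space renewal. \<forall>t<m. code q t = b t}"

text \<open>Half of the comparison of topologies: finitely many code symbols of a point suffice to
  stay inside a given open set around it.\<close>

lemma openin_contains_code_cylinder:
  assumes U: "openin (shift_topology renewal) U" "p \<in> U"
  shows "\<exists>m. code_cylinder (code p) m \<subseteq> U"
proof -
  obtain D where D: "D \<in> shift_basis renewal" "p \<in> D" "D \<subseteq> U"
    using U unfolding openin_shift_topology_iff by blast
  have p: "p \<in> shift_space renewal"
    using shift_basis_subset_shift_space[OF D(1)] D(2) by blast
  have "\<exists>m. code_cylinder (code p) m \<subseteq> D"
  proof (cases p)
    case (InfP x)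
    obtain m where m: "\<And>n. m < n \<Longrightarrow> cyl renewal (map x [0..<n]) (rng renewal (x (n - 1))) \<subseteq> D"
      using basis_nhd_Inf[OF D(1)] D(2) InfP by blast
    \<comment> \<open>The prefix is extended to the next e, since only then does the code prefix fix
      the edges.\<close>
    obtain k where k: "code p (m + k)"
    proof (cases "x m")
      case Edge_e
      then show thesis using that[of 0] InfP by (simp add: code_def)
    next
      case (Edge_f k)
      then show thesis using code_after_Edge_f[OF p, of m k] that InfP by auto
    qed
    define n where "n = Suc (m + k)"
    have xn: "x (n - 1) = Edge_e" using k InfP by (simp add: code_def n_def)
    have "code_cylinder (code p) n \<subseteq> cyl renewal (map x [0..<n]) (rng renewal (x (n - 1)))"
    proof
      fix q assume "q \<in> code_cylinder (code p) n"
      then have q: "q \<in> shift_space renewal" "\<And>t. t < n \<Longrightarrow> code q t = code p t"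
        by (auto simp: code_cylinder_def)
      have "enat t < ulength q \<and> edge_at q t = x t" if "t < n" for t
        using edge_at_cong[OF p q, of n t] that k InfP by (simp add: n_def)
      then obtain \<gamma> where \<gamma>: "q = uconc (map x [0..<n]) \<gamma>"
        by (metis upath_prefixE[of "map x [0..<n]" q] length_map length_upt minus_nat.diff_0 nth_map_upt add_0)
      show "q \<in> cyl renewal (map x [0..<n]) (rng renewal (x (n - 1)))"
      proof (cases "1 \<le> ulength \<gamma>")
        case True
        then show ?thesis unfolding cyl_def xn using \<gamma> q(1) by auto
      next
        \<comment> \<open>Here \<open>q\<close> stops right after the prefix. The prefix ends in e,
          so \<open>q\<close> is one of the finite points that \<open>cyl\<close> contains.\<close>
        case False
        then obtain A where "\<gamma> = FinP [] A" by (cases \<gamma>) (auto simp: one_enat_def Suc_le_eq)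
        then show ?thesis
          using \<gamma> q(1) xn by (auto simp: cyl_def FinP_in_shift_space_renewal min_emitters_in_range_renewal n_def)
      qed
    qed
    moreover have "m < n" by (simp add: n_def)
    ultimately show ?thesis using m by blast
  next
    case (FinP \<alpha> A)
    then have A: "A = {1..}" and \<alpha>: "\<alpha> = [] \<or> finite_path renewal \<alpha> \<and> last \<alpha> = Edge_e"
      using p by (auto simp: FinP_in_shift_space_renewal)
    obtain F where F: "finite F" "cyl_minus renewal \<alpha> A F \<subseteq> D"
      using basis_nhd_Fin[OF D(1)] D(2) FinP by blast
    have "finite (Edge_f -` F)"
      using F(1) by (intro finite_vimageI) (auto simp: inj_on_def)
    then obtain M where M: "\<And>k. Edge_f k \<in> F \<Longrightarrow> k < M"
      unfolding finite_nat_set_iff_bounded by auto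
    \<comment> \<open>\<open>M + 1\<close> zeros after \<alpha> rule out a continuation by e or by
      \<open>f_k\<close> with \<open>k \<le> M\<close>, hence by any edge of
      \<open>F\<close>.\<close>
    define n where "n = length \<alpha> + Suc M"
    have "code_cylinder (code p) n \<subseteq> cyl_minus renewal \<alpha> A F"
    proof
      fix q assume "q \<in> code_cylinder (code p) n"
      then have q: "q \<in> shift_space renewal" "\<And>t. t < n \<Longrightarrow> code q t = code p t"
        by (auto simp: code_cylinder_def)
      have "enat t < ulength q \<and> edge_at q t = \<alpha> ! t" if "t < length \<alpha>" for t
      proof -
        have "code p (length \<alpha> - 1)"
          using \<alpha> that FinP by (auto simp: code_def finite_path_def last_conv_nth)
        then show ?thesis
          using edge_at_cong[OF p q(1), of "length \<alpha>" t] q(2) that FinP by (simp add: n_def)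
      qed
      then obtain \<gamma> where \<gamma>: "q = uconc \<alpha> \<gamma>"
        using upath_prefixE[of \<alpha> q] by metis
      show "q \<in> cyl_minus renewal \<alpha> A F"
      proof (cases "1 \<le> ulength \<gamma>")
        case True
        then have len: "enat (length \<alpha>) < ulength q"
          unfolding \<gamma> ulength_uconc by (cases \<gamma>) (auto simp: one_enat_def)
        have edge: "edge_at q (length \<alpha>) = first_edge \<gamma>"
          using edge_at_uconc_length[OF True] \<gamma> by simp
        have code0: "\<not> code q t" if "length \<alpha> \<le> t" "t < n" for t
          using q(2)[OF that(2)] that(1) FinP by (simp add: code_def)
        have "first_edge \<gamma> \<notin> F"
        proof (cases "first_edge \<gamma>")
          case Edge_e
          then have "code q (length \<alpha>)" using len edge by (simp add: code_def)
          then show ?thesis using code0 by (simp add: n_def)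
        next
          case (Edge_f k)
          then have "code q (length \<alpha> + k)"
            using code_after_Edge_f[OF q(1) len] edge by simp
          then have "M < k" using code0[of "length \<alpha> + k"] by (force simp: n_def)
          then show ?thesis using M Edge_f by force
        qed
        moreover have "first_edge \<gamma> \<in> emitted renewal A"
          using edge_at_in_edges[OF q(1) len] edge A emitted_renewal_all by simp
        ultimately show ?thesis unfolding cyl_minus_def using \<gamma> q(1) True by blast
      next
        case False
        then obtain A' where "\<gamma> = FinP [] A'" by (cases \<gamma>) (auto simp: one_enat_def Suc_le_eq)
        then show ?thesis
          using \<gamma> q(1) A by (auto simp: cyl_minus_def FinP_in_shift_space_renewal)
      qed
    qed
    then show ?thesis using F(2) by blast
  qed
  then show ?thesis using D(3) by blast
qed

text \<open>The other half of the comparison: code cylinders are open, by exhibiting a basic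
  neighbourhood of each point.\<close>

lemma openin_code_cylinder: "openin (shift_topology renewal) (code_cylinder b m)"
  unfolding openin_shift_topology_iff
proof
  fix p assume p: "p \<in> code_cylinder b m"
  then have pX: "p \<in> shift_space renewal" and pb: "\<And>t. t < m \<Longrightarrow> b t = code p t"
    by (auto simp: code_cylinder_def)
  show "\<exists>D\<in>shift_basis renewal. p \<in> D \<and> D \<subseteq> code_cylinder b m"
  proof (cases p)
    case (InfP x)
    then have x: "infinite_path renewal x" using pX by (simp add: InfP_in_shift_space)
    \<comment> \<open>Length \<open>m + 1\<close> keeps the prefix nonempty when
      \<open>m = 0\<close>.\<close>
    define D where "D = cyl renewal (map x [0..<Suc m]) (rng renewal (x (Suc m - 1)))"
    have D: "D \<in> shift_basis renewal" "p \<in> D"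
      using cyl_prefix_in_basis[OF x, of "Suc m"] InfP by (auto simp: D_def simp del: upt_Suc)
    moreover have "D \<subseteq> code_cylinder b m"
    proof
      fix q assume q: "q \<in> D"
      then have qX: "q \<in> shift_space renewal" using D(1) shift_basis_subset_shift_space by blast
      have "\<exists>\<gamma>. q = uconc (map x [0..<Suc m]) \<gamma>"
        using q unfolding D_def cyl_def by (force intro: exI[of _ "FinP [] _"] simp del: upt_Suc)
      then obtain \<gamma> where \<gamma>: "q = uconc (map x [0..<Suc m]) \<gamma>" by blast
      have "code q t = code p t" if "t < m" for t
        unfolding \<gamma> code_uconc using that InfP by (simp add: code_def nth_append)
      then show "q \<in> code_cylinder b m" using qX pb by (simp add: code_cylinder_def)
    qed
    ultimately show ?thesis by blast
  next
    case (FinP \<alpha> A)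
    then have A: "A = {1..}" using pX by (simp add: FinP_in_shift_space_renewal)
    \<comment> \<open>Without these edges any continuation of \<alpha> starts with
      \<open>f_k\<close>, \<open>k > m\<close>, and so adds no 1 before position
      \<open>m\<close>.\<close>
    define F where "F = insert Edge_e (Edge_f ` {1..m})"
    define D where "D = cyl_minus renewal \<alpha> A F"
    have "FinP \<alpha> A \<in> X_fin renewal"
      using pX FinP by (simp add: FinP_in_shift_space_renewal FinP_in_X_fin_renewal)
    moreover have "F \<subseteq> emitted renewal A" "finite F"
      unfolding A emitted_renewal_all by (auto simp: F_def edges_renewal)
    ultimately have D: "D \<in> shift_basis renewal" "p \<in> D"
      using FinP by (auto simp: shift_basis_def D_def cyl_minus_def)
    moreover have "D \<subseteq> code_cylinder b m"
    proof
      fix q assume q: "q \<in> D"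
      then have qX: "q \<in> shift_space renewal" using D(1) shift_basis_subset_shift_space by blast
      have "code q t = code p t" if "t < m" for t
      proof (cases "q = p")
        case False
        then obtain \<gamma> where \<gamma>: "q = uconc \<alpha> \<gamma>" "1 \<le> ulength \<gamma>" "first_edge \<gamma> \<in> edges renewal - F"
          using q FinP unfolding D_def cyl_minus_def A emitted_renewal_all by blast
        then obtain k where k: "first_edge \<gamma> = Edge_f k" "m < k"
          by (cases "first_edge \<gamma>") (force simp: F_def edges_renewal)+
        have len: "enat (length \<alpha>) < ulength q"
          using \<gamma>(2) unfolding \<gamma>(1) ulength_uconc by (cases \<gamma>) (auto simp: one_enat_def)
        have "edge_at q (length \<alpha>) = Edge_f k"
          using edge_at_uconc_length[OF \<gamma>(2)] \<gamma>(1) k(1) by simp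
        from code_after_Edge_f[OF qX len this] have "\<not> code q t" if "length \<alpha> \<le> t"
          using that \<open>t < m\<close> k(2) by (metis le_add_diff_inverse less_imp_diff_less less_trans)
        then show ?thesis
          using code_uconc[of \<alpha> \<gamma> t] unfolding \<gamma>(1) FinP code_def[of "FinP \<alpha> A"] by auto
      qed simp
      then show "q \<in> code_cylinder b m" using qX pb by (simp add: code_cylinder_def)
    qed
    ultimately show ?thesis by blast
  qed
qed

section \<open>Compactness and Lebesgue numbers\<close>

lemma compactin_shift_space_renewal: "compactin (shift_topology renewal) (shift_space renewal)"
  unfolding compactin_def
proof (intro conjI allI impI)
  show "shift_space renewal \<subseteq> topspace (shift_topology renewal)"
    by (simp add: topspace_shift_topology)
next
  fix \<U> assume \<U>: "Ball \<U> (openin (shift_topology renewal)) \<and> shift_space renewal \<subseteq> \<Union>\<U>"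
  \<comment> \<open>\<open>dec\<close> is a section of \<open>code\<close>. Pulling the cover back
    along it gives a cover of the Cantor space, compact by Tychonoff.\<close>
  obtain dec where dec: "\<And>b. dec b \<in> shift_space renewal" "\<And>b. code (dec b) = b"
    using code_surj by metis
  define P where "P = product_topology (\<lambda>_. discrete_topology (UNIV :: bool set)) (UNIV :: nat set)"
  define W where "W U = {b. dec b \<in> U}" for U
  have topP: "topspace P = UNIV" by (simp add: P_def PiE_UNIV_domain)
  have "compact_space P"
    by (simp add: P_def compact_space_product_topology compact_space_discrete_topology)
  then have P: "compactin P UNIV" by (simp add: compact_space_def topP)
  have openW: "openin P (W U)" if U: "U \<in> \<U>" for U
    unfolding P_def openin_product_topology_alt
  proof
    fix b assume "b \<in> W U"
    then obtain m where m: "code_cylinder b m \<subseteq> U"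
      using openin_contains_code_cylinder[of U "dec b"] \<U> U by (auto simp: W_def dec(2))
    define u where "u i = (if i < m then {b i} else UNIV)" for i
    have "{i. u i \<noteq> UNIV} \<subseteq> {..<m}" by (auto simp: u_def)
    then have "finite {i. u i \<noteq> UNIV}" using finite_subset by blast
    moreover have "Pi UNIV u \<subseteq> W U"
      using m dec by (force simp: W_def u_def code_cylinder_def Pi_iff split: if_splits)
    moreover have "b \<in> Pi UNIV u" by (auto simp: u_def)
    ultimately show "\<exists>u. finite {i \<in> UNIV. u i \<noteq> topspace (discrete_topology UNIV)} \<and>
        (\<forall>i\<in>UNIV. openin (discrete_topology UNIV) (u i)) \<and> b \<in> Pi\<^sub>E UNIV u \<and> Pi\<^sub>E UNIV u \<subseteq> W U"
      by (intro exI[of _ u]) (simp add: PiE_UNIV_domain)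
  qed
  have "UNIV \<subseteq> \<Union>(W ` \<U>)"
  proof
    fix b
    obtain U where "U \<in> \<U>" "dec b \<in> U"
      using subsetD[OF conjunct2[OF \<U>] dec(1)] by blast
    then show "b \<in> \<Union>(W ` \<U>)" by (auto simp: W_def)
  qed
  moreover have "openin P V" if "V \<in> W ` \<U>" for V
    using that openW by blast
  ultimately have "\<exists>\<W>. finite \<W> \<and> \<W> \<subseteq> W ` \<U> \<and> UNIV \<subseteq> \<Union>\<W>"
    by (intro compactinD[OF P])
  then obtain \<W> where "finite \<W>" "\<W> \<subseteq> W ` \<U>" "UNIV \<subseteq> \<Union>\<W>"
    by blast
  then obtain \<F> where \<F>: "finite \<F>" "\<F> \<subseteq> \<U>" "UNIV \<subseteq> \<Union>(W ` \<F>)"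
    by (metis finite_subset_image)
  have "shift_space renewal \<subseteq> \<Union>\<F>"
  proof
    fix p assume p: "p \<in> shift_space renewal"
    obtain U where U: "U \<in> \<F>" "dec (code p) \<in> U"
      using \<F>(3) by (auto simp: W_def)
    \<comment> \<open>An open set containing \<open>dec (code p)\<close> contains every point whose
      code is that of \<open>p\<close>, in particular \<open>p\<close>.\<close>
    then obtain m where "code_cylinder (code p) m \<subseteq> U"
      using openin_contains_code_cylinder[of U "dec (code p)"] \<U> \<F>(2) by (auto simp: dec(2))
    then show "p \<in> \<Union>\<F>" using U(1) p by (auto simp: code_cylinder_def)
  qed
  then show "\<exists>\<F>. finite \<F> \<and> \<F> \<subseteq> \<U> \<and> shift_space renewal \<subseteq> \<Union>\<F>"
    using \<F> by blast
qed

text \<open>Finitely many cylinders suffice for \<open>K\<close>. Any point of a cylinder serves as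
  its centre, so the largest of their lengths works everywhere.\<close>

lemma code_Lebesgue_number:
  assumes K: "compactin (shift_topology renewal) K" and \<alpha>: "open_cover (shift_topology renewal) K \<alpha>"
  shows "\<exists>m. \<forall>p\<in>K. \<exists>U\<in>\<alpha>. code_cylinder (code p) m \<subseteq> U"
proof -
  have KX: "K \<subseteq> shift_space renewal"
    using compactin_subset_topspace[OF K] by (simp add: topspace_shift_topology)
  have "\<exists>m. \<exists>U\<in>\<alpha>. code_cylinder (code p) m \<subseteq> U" if "p \<in> K" for p
    using \<alpha> that openin_contains_code_cylinder unfolding open_cover_def by (meson UnionE subsetD)
  then obtain m where m: "\<And>p. p \<in> K \<Longrightarrow> \<exists>U\<in>\<alpha>. code_cylinder (code p) (m p) \<subseteq> U"
    by metis
  have "\<exists>P. finite P \<and> P \<subseteq> K \<and> K \<subseteq> \<Union>((\<lambda>p. code_cylinder (code p) (m p)) ` P)"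
  proof -
    let ?\<C> = "(\<lambda>p. code_cylinder (code p) (m p)) ` K"
    have "K \<subseteq> \<Union>?\<C>" using KX by (auto simp: code_cylinder_def)
    moreover have "openin (shift_topology renewal) C" if "C \<in> ?\<C>" for C
      using that openin_code_cylinder by blast
    ultimately have "\<exists>\<F>. finite \<F> \<and> \<F> \<subseteq> ?\<C> \<and> K \<subseteq> \<Union>\<F>"
      by (intro compactinD[OF K])
    then obtain \<F> where \<F>: "finite \<F>" "\<F> \<subseteq> ?\<C>" "K \<subseteq> \<Union>\<F>"
      by blast
    obtain P where "P \<subseteq> K" "finite P" "\<F> = (\<lambda>p. code_cylinder (code p) (m p)) ` P"
      using finite_subset_image[OF \<F>(1,2)] by blast
    then show ?thesis using \<F>(3) by blast
  qed
  then obtain P where P: "finite P" "P \<subseteq> K" "K \<subseteq> \<Union>((\<lambda>p. code_cylinder (code p) (m p)) ` P)"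
    by blast
  define M where "M = Max (m ` P)"
  have "\<exists>U\<in>\<alpha>. code_cylinder (code p) M \<subseteq> U" if p: "p \<in> K" for p
  proof -
    obtain r where r: "r \<in> P" "p \<in> code_cylinder (code r) (m r)"
      using subsetD[OF P(3) p] by blast
    have "m r \<le> M" unfolding M_def using P(1) r(1) by simp
    then have "code_cylinder (code p) M \<subseteq> code_cylinder (code r) (m r)"
      using r(2) by (auto simp: code_cylinder_def)
    then show ?thesis using m[of r] r(1) P(2) by blast
  qed
  then show ?thesis by blast
qed


section \<open>The entropy of the renewal shift\<close>

lemma shift_domain_subset_topspace: "shift_domain G \<subseteq> topspace (shift_topology G)"
  by (auto simp: shift_domain_def topspace_shift_topology)

lemma open_cover_subset_Pow: "open_cover T K \<alpha> \<Longrightarrow> \<alpha> \<subseteq> Pow (topspace T)"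
  by (auto simp: open_cover_def dest: openin_subset)

lemma open_cover_finite_subcover:
  assumes "compactin T K" "open_cover T K \<alpha>"
  obtains \<F> where "finite \<F>" "\<F> \<subseteq> \<alpha>" "K \<subseteq> \<Union>\<F>"
proof -
  have "\<exists>\<F>. finite \<F> \<and> \<F> \<subseteq> \<alpha> \<and> K \<subseteq> \<Union>\<F>"
    using assms(2) by (intro compactinD[OF assms(1)]) (auto simp: open_cover_def)
  then show thesis using that by blast
qed

section \<open>Upper bound for every compact set and cover\<close>

lemma renewal_entropy_upper:
  assumes K: "compactin (shift_topology renewal) K" and \<alpha>: "open_cover (shift_topology renewal) K \<alpha>"
  shows "cover_entropy (shift_topology renewal) (shift_domain renewal) shift \<alpha> K \<le> ln 2"
proof -
  let ?T = "shift_topology renewal" and ?D = "shift_domain renewal"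
  note D = shift_domain_subset_topspace[of renewal]
  note \<alpha>P = open_cover_subset_Pow[OF \<alpha>]
  define N where "N n = cover_number (iter_join ?T ?D shift \<alpha> n) (iter_inter ?T ?D shift K n)" for n
  obtain \<F> where \<F>: "finite \<F>" "\<F> \<subseteq> \<alpha>" "K \<subseteq> \<Union>\<F>"
    using open_cover_finite_subcover[OF K \<alpha>] by blast
  have N1: "1 \<le> N n" for n
    unfolding N_def by (rule cover_number_ge_1[OF iter_join_finite_subcover[OF D \<alpha>P \<F>]])
  obtain m U where U: "\<And>p. p \<in> K \<Longrightarrow> U p \<in> \<alpha>" "\<And>p. p \<in> K \<Longrightarrow> code_cylinder (code p) m \<subseteq> U p"
    using code_Lebesgue_number[OF K \<alpha>] by metis
  \<comment> \<open>At time \<open>i \<le> n\<close> the choice of \<open>U\<close> needs the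
    symbols \<open>i\<close> to \<open>i + m - 1\<close>, all below \<open>n + m\<close>.\<close>
  have N2: "N n \<le> 2 ^ (n + m)" for n
  proof (cases "iter_inter ?T ?D shift K n = {}")
    case True
    then show ?thesis by (simp add: N_def cover_number_def)
  next
    case False
    let ?K = "iter_inter ?T ?D shift K n"
    define w where "w p = {t. t < n + m \<and> code p t}" for p :: "(nat, renewal_edge) upath"
    define A where "A p = (\<Inter>i\<le>n. iter_preimage ?T ?D shift i (U ((shift ^^ i) p)))" for p
    \<comment> \<open>One representative orbit per code word that occurs; its itinerary serves all
      points with the same word, so words bound the cover number.\<close>
    define \<B> where "\<B> = (\<lambda>s. A (inv_into ?K w s)) ` w ` ?K"
    have K_iter: "(shift ^^ i) p \<in> K" "p \<in> iter_dom ?T ?D shift i" if "p \<in> ?K" "i \<le> n" for p i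
      using that by (auto simp: iter_inter_def iter_preimage_def)
    have A: "A p \<in> iter_join ?T ?D shift \<alpha> n" if "p \<in> ?K" for p
      unfolding iter_join_iff[OF D \<alpha>P] A_def
      using U(1) K_iter(1)[OF that] by (intro exI[of _ "\<lambda>i. U ((shift ^^ i) p)"]) simp
    have "\<B> \<subseteq> iter_join ?T ?D shift \<alpha> n"
      unfolding \<B>_def using A inv_into_into by (metis image_subsetI)
    moreover have w: "w ` ?K \<subseteq> Pow {..<n + m}" by (auto simp: w_def)
    then have fin: "finite (w ` ?K)" by (rule finite_subset) simp
    then have "finite \<B>" by (simp add: \<B>_def)
    moreover have "?K \<subseteq> \<Union>\<B>"
    proof
      fix p assume p: "p \<in> ?K"
      define r where "r = inv_into ?K w (w p)"
      have r: "r \<in> ?K" "w r = w p"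
        unfolding r_def using p by (simp_all add: inv_into_into f_inv_into_f)
      have code: "code p t = code r t" if "t < n + m" for t
        using r(2) that by (auto simp: w_def)
      have "p \<in> iter_preimage ?T ?D shift i (U ((shift ^^ i) r))" if i: "i \<le> n" for i
      proof -
        have "(shift ^^ i) p \<in> shift_space renewal"
          using K_iter(1)[OF p i] compactin_subset_topspace[OF K] by (auto simp: topspace_shift_topology)
        then have "(shift ^^ i) p \<in> code_cylinder (code ((shift ^^ i) r)) m"
          using code i by (auto simp: code_cylinder_def code_shift_funpow)
        then show ?thesis
          using U(2)[OF K_iter(1)[OF r(1) i]] K_iter(2)[OF p i] by (auto simp: iter_preimage_def)
      qed
      then have "p \<in> A r" by (simp add: A_def)
      then show "p \<in> \<Union>\<B>" using p by (auto simp: \<B>_def r_def)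
    qed
    ultimately have "N n \<le> card \<B>"
      unfolding N_def using False by (intro cover_number_le) auto
    also have "\<dots> \<le> card (w ` ?K)" unfolding \<B>_def using fin by (rule card_image_le)
    also have "\<dots> \<le> card (Pow {..<n + m})" using w by (intro card_mono) auto
    finally show ?thesis by (simp add: card_Pow)
  qed
  have "(\<lambda>n. 1 / real n * ln (real (N n))) \<longlonglongrightarrow> cover_entropy ?T ?D shift \<alpha> K"
    unfolding N_def by (rule cover_entropy_LIMSEQ[OF D \<alpha>P \<F>])
  moreover have "(\<lambda>n. (1 + real m / real n) * ln 2) \<longlonglongrightarrow> (1 + 0) * ln 2"
    by (intro tendsto_mult tendsto_add tendsto_const lim_const_over_n)
  moreover have "1 / real n * ln (real (N n)) \<le> (1 + real m / real n) * ln 2" if "n \<ge> 1" for n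
  proof -
    have "real (N n) \<le> 2 ^ (n + m)"
      using N2[of n] by (metis of_nat_le_iff of_nat_numeral of_nat_power)
    then have "ln (real (N n)) \<le> ln (2 ^ (n + m))"
      using N1[of n] by (subst ln_le_cancel_iff) auto
    also have "\<dots> = (real n + real m) * ln 2" by (simp add: ln_realpow)
    finally show ?thesis using that by (simp add: field_simps)
  qed
  ultimately show ?thesis by (intro LIMSEQ_le[of _ _ _ "ln 2"]) auto
qed

section \<open>Lower bound from infinite paths, which never leave the domain\<close>

lemma InfP_in_iter_dom:
  "infinite_path G x \<Longrightarrow> InfP x \<in> iter_dom (shift_topology G) (shift_domain G) shift n"
proof (induction n arbitrary: x)
  case (Suc n)
  have "infinite_path G (\<lambda>i. x (Suc i))" using Suc.prems by (simp add: infinite_path_def)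
  then show ?case using Suc by (simp add: shift_domain_def InfP_in_shift_space)
qed (simp add: topspace_shift_topology InfP_in_shift_space)

lemma renewal_entropy_lower:
  "\<exists>\<alpha>. open_cover (shift_topology renewal) (shift_space renewal) \<alpha> \<and>
    ln 2 \<le> cover_entropy (shift_topology renewal) (shift_domain renewal) shift \<alpha> (shift_space renewal)"
proof (intro exI conjI)
  let ?T = "shift_topology renewal" and ?D = "shift_domain renewal" and ?X = "shift_space renewal"
  define \<alpha> where "\<alpha> = range (\<lambda>c. code_cylinder (\<lambda>_. c) 1)"
  show \<alpha>: "open_cover ?T ?X \<alpha>"
  proof -
    have "p \<in> code_cylinder (\<lambda>_. code p 0) 1" if "p \<in> ?X" for p
      using that by (simp add: code_cylinder_def)
    then show ?thesis
      unfolding open_cover_def \<alpha>_def using openin_code_cylinder by blast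
  qed
  note D = shift_domain_subset_topspace[of renewal]
  note \<alpha>P = open_cover_subset_Pow[OF \<alpha>]
  have \<F>: "finite \<alpha>" "\<alpha> \<subseteq> \<alpha>" "?X \<subseteq> \<Union>\<alpha>"
    using \<alpha> by (auto simp: \<alpha>_def open_cover_def)
  define N where "N n = cover_number (iter_join ?T ?D shift \<alpha> n) (iter_inter ?T ?D shift ?X n)" for n
  \<comment> \<open>Only words on the positions below \<open>n\<close> are counted;
    \<open>2 ^ n\<close> already has the right growth rate.\<close>
  have N: "2 ^ n \<le> N n" for n
  proof -
    let ?K = "iter_inter ?T ?D shift ?X n"
    have "\<exists>p\<in>?K. \<forall>i\<le>n. code p i \<longleftrightarrow> i \<in> S" for S
    proof -
      \<comment> \<open>Ones at all positions beyond \<open>n\<close> force the path to be infinite,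
        so all its iterates are defined.\<close>
      obtain p where p: "p \<in> ?X" "code p = (\<lambda>i. i \<in> S \<or> n < i)" using code_surj by meson
      have "\<exists>x. p = InfP x"
      proof (cases p)
        case (FinP \<beta> A)
        then have "\<not> code p (length \<beta> + n + 1)" by (simp add: code_def)
        then show ?thesis by (simp add: p(2))
      qed simp
      then obtain x where x: "p = InfP x" by blast
      have "(shift ^^ i) p = InfP (\<lambda>j. x (i + j))" for i
        by (induction i) (auto simp: x)
      moreover have "InfP (\<lambda>j. x (i + j)) \<in> ?X" for i
        using p(1) by (simp add: x InfP_in_shift_space infinite_path_def)
      ultimately have "p \<in> ?K"
        using InfP_in_iter_dom[of renewal x] p(1)
        by (auto simp: iter_inter_def iter_preimage_def x[symmetric] InfP_in_shift_space[symmetric])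
      then show ?thesis using p(2) by (intro bexI[of _ p]) auto
    qed
    then obtain p where p: "\<And>S. p S \<in> ?K" "\<And>S i. i \<le> n \<Longrightarrow> code (p S) i \<longleftrightarrow> i \<in> S"
      by metis
    then have "?K \<noteq> {}" by blast
    then obtain \<B> where \<B>: "\<B> \<subseteq> iter_join ?T ?D shift \<alpha> n" "finite \<B>" "?K \<subseteq> \<Union>\<B>" "card \<B> = N n"
      unfolding N_def by (rule cover_number_attained[OF _ iter_join_finite_subcover[OF D \<alpha>P \<F>]])
    have "\<exists>B\<in>\<B>. p S \<in> B" for S using p(1) \<B>(3) by blast
    then obtain b where b: "\<And>S. b S \<in> \<B>" "\<And>S. p S \<in> b S" by metis
    \<comment> \<open>A member of the join prescribes the symbol at each time
      \<open>i \<le> n\<close>, so it cannot contain the chosen points of two different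
      words.\<close>
    have "inj_on b (Pow {..<n})"
    proof
      fix S S' assume S: "S \<in> Pow {..<n}" "S' \<in> Pow {..<n}" "b S = b S'"
      obtain u where u: "\<And>i. i \<le> n \<Longrightarrow> u i \<in> \<alpha>" "b S = (\<Inter>i\<le>n. iter_preimage ?T ?D shift i (u i))"
        using subsetD[OF \<B>(1) b(1)] unfolding iter_join_iff[OF D \<alpha>P] by blast
      have "i \<in> S \<longleftrightarrow> i \<in> S'" if i: "i < n" for i
      proof -
        have "(shift ^^ i) (p S) \<in> u i" "(shift ^^ i) (p S') \<in> u i"
          using b(2)[of S] b(2)[of S'] u(2) S(3) i by (auto simp: iter_preimage_def)
        moreover obtain c where "u i = code_cylinder (\<lambda>_. c) 1"
          using u(1)[of i] i by (auto simp: \<alpha>_def)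
        ultimately have "code (p S) i = code (p S') i"
          by (auto simp: code_cylinder_def code_shift_funpow)
        then show ?thesis using p(2) i by auto
      qed
      then show "S = S'" using S(1,2) by blast
    qed
    then have "card (Pow {..<n}) \<le> card \<B>"
      using b(1) \<B>(2) by (intro card_inj_on_le) auto
    then show ?thesis by (simp add: card_Pow \<B>(4))
  qed
  have "(\<lambda>n. 1 / real n * ln (real (N n))) \<longlonglongrightarrow> cover_entropy ?T ?D shift \<alpha> ?X"
    unfolding N_def by (rule cover_entropy_LIMSEQ[OF D \<alpha>P \<F>])
  moreover have "ln 2 \<le> 1 / real n * ln (real (N n))" if "n \<ge> 1" for n
  proof -
    have "(2::real) ^ n \<le> real (N n)"
      using N[of n] by (metis of_nat_le_iff of_nat_numeral of_nat_power)
    moreover have "(0::real) < 2 ^ n" by simp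
    ultimately have "ln (2 ^ n) \<le> ln (real (N n))"
      by (subst ln_le_cancel_iff) linarith+
    then show ?thesis using that by (simp add: ln_realpow field_simps)
  qed
  ultimately show "ln 2 \<le> cover_entropy ?T ?D shift \<alpha> ?X"
    by (intro LIMSEQ_le_const) auto
qed

theorem mainTheorem8:
  "topological_entropy (shift_topology renewal) (shift_domain renewal) shift = ereal (ln 2)"
proof (rule antisym)
  show "topological_entropy (shift_topology renewal) (shift_domain renewal) shift \<le> ereal (ln 2)"
    unfolding topological_entropy_def compact_entropy_def
    using renewal_entropy_upper by (intro SUP_least) simp
  obtain \<alpha> where "open_cover (shift_topology renewal) (shift_space renewal) \<alpha>"
    "ln 2 \<le> cover_entropy (shift_topology renewal) (shift_domain renewal) shift \<alpha> (shift_space renewal)"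
    using renewal_entropy_lower by blast
  then have "ereal (ln 2) \<le>
      compact_entropy (shift_topology renewal) (shift_domain renewal) shift (shift_space renewal)"
    unfolding compact_entropy_def by (intro SUP_upper2[of \<alpha>]) auto
  then show "ereal (ln 2) \<le> topological_entropy (shift_topology renewal) (shift_domain renewal) shift"
    unfolding topological_entropy_def
    using compactin_shift_space_renewal by (intro SUP_upper2[of "shift_space renewal"]) auto
qed

end
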